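(* Let $r\ge 3$ and $n>2r$ be integers, and let $\mathcal H$ be an $n$-vertex $r$-uniform hypergraph with no Berge Hamiltonian cycle. Let $k$ be an integer with $$r+1\le k<\binom{\lfloor (n-1)/2\rfloor}{r-1},$$ and let $t$ be the unique integer satisfying $\binom{t-1}{r-1}<k\le\binom{t}{r-1}$. If $\delta(\mathcal H)\ge k$, then $$e(\mathcal H)\le\begin{cases}\max\left\{g_r(n,t),\ g_r\left(n,\left\lfloor\frac{n-1}{2}\right\rfloor\right)\right\}, & n\text{ odd},\\[4pt] \max\left\{g_r(n,t),\ g_r\left(n,\frac{n-2}{2}\right)+\frac n2-1\right\}, & n\text{ even}.\end{cases}$$ Moreover, for odd $n$ the bound is attained by the corresponding hypergraph $\mathcal H^{(1)}_{n,s}$, where $s\in\{t,\lfloor (n-1)/2\rfloor\}$ is the value giving the maximum; that is, this hypergraph is an $n$-vertex $r$-uniform hypergraph with no Berge Hamiltonian cycle, with minimum degree at least $k$, and with exactly $g_r(n,s)$ edges.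
   Context: All hypergraphs are finite and simple; $r$-uniform means every hyperedge has exactly $r$ vertices. $e(\mathcal H)$ is the number of hyperedges and $\delta(\mathcal H)$ is the minimum vertex degree (the degree of a vertex is the number of hyperedges containing it). For a set $X$, $\binom{X}{s}$ denotes the family of $s$-subsets of $X$. A Berge cycle of length $\ell$ in $\mathcal H$ is an alternating sequence $v_1,E_1,v_2,E_2,\ldots,v_\ell,E_\ell$ of distinct vertices $v_1,\ldots,v_\ell$ and distinct hyperedges $E_1,\ldots,E_\ell$ such that $v_i,v_{i+1}\in E_i$ for every $i$ (indices modulo $\ell$). A Berge Hamiltonian cycle is a Berge cycle whose defining vertices $v_1,\dots,v_\ell$ are all the vertices of the hypergraph. For integers $n,t$, $g_r(n,t)=\binom{n-t}{r}+t\binom{t}{r-1}$. The $r$-uniform hypergraph $\mathcal H^{(1)}_{n,t}$: let $T$ and $S$ be disjoint sets with $|T|=|S|=t$, and let $A$ be a set of size $n-t$ disjoint from $T$ and containing $S$. The vertex set is $T\cup A$, and the edges are all $r$-subsets of $A$ together with all $r$-sets $\{x\}\cup R$ with $x\in T$ and $R\in\binom{S}{r-1}$. *)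

theory Defs
  imports Complex_Main "HOL-Library.Ramsey"
begin

text \<open>
  A hypergraph is given by its vertex set \<open>V\<close> and its hyperedge set \<open>E\<close>; simplicity is built in,
  since \<open>E\<close> is a set of vertex sets. The family of all \<open>s\<close>-subsets of \<open>X\<close> is \<open>nsets X s\<close>.
\<close>

definition uniform_hypergraph :: "nat \<Rightarrow> 'a set \<Rightarrow> 'a set set \<Rightarrow> bool" where
  "uniform_hypergraph r V E \<longleftrightarrow> finite V \<and> E \<subseteq> nsets V r"

definition degree :: "'a set set \<Rightarrow> 'a \<Rightarrow> nat" where
  "degree E v = card {e \<in> E. v \<in> e}"

text \<open>Meaningful only for a finite nonempty vertex set.\<close>

definition min_degree :: "'a set \<Rightarrow> 'a set set \<Rightarrow> nat" where
  "min_degree V E = Min (degree E ` V)"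

text \<open>
  The lists hold \<open>v\<^sub>1, \<dots>, v\<^sub>l\<close> and \<open>E\<^sub>1, \<dots>, E\<^sub>l\<close>, indexed from 0.
\<close>

definition berge_cycle :: "'a set set \<Rightarrow> 'a list \<Rightarrow> 'a set list \<Rightarrow> bool" where
  "berge_cycle E vs es \<longleftrightarrow>
     vs \<noteq> [] \<and> length es = length vs \<and> distinct vs \<and> distinct es \<and> set es \<subseteq> E \<and>
     (\<forall>i < length vs. vs ! i \<in> es ! i \<and> vs ! ((i + 1) mod length vs) \<in> es ! i)"

definition has_berge_hamiltonian_cycle :: "'a set \<Rightarrow> 'a set set \<Rightarrow> bool" where
  "has_berge_hamiltonian_cycle V E \<longleftrightarrow> (\<exists>vs es. berge_cycle E vs es \<and> set vs = V)"

definition g :: "nat \<Rightarrow> nat \<Rightarrow> nat \<Rightarrow> nat" where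
  "g r n t = ((n - t) choose r) + t * (t choose (r - 1))"

text \<open>
  The hypergraph \<open>H\<^sup>(\<^sup>1\<^sup>)\<close> with parameters \<open>n\<close> and \<open>t\<close> is determined only up to the choice of the sets
  \<open>T\<close>, \<open>S\<close>, \<open>A\<close>, so it is rendered as a predicate on \<open>(V, E)\<close>. The subtraction \<open>n - t\<close> does
  not truncate, as \<open>S \<subseteq> A\<close> forces \<open>2 * t \<le> n\<close>.
\<close>

definition is_H1 :: "nat \<Rightarrow> nat \<Rightarrow> nat \<Rightarrow> 'a set \<Rightarrow> 'a set set \<Rightarrow> bool" where
  "is_H1 r n t V E \<longleftrightarrow>
     (\<exists>T S A. finite T \<and> finite A \<and> card T = t \<and> card S = t \<and> card A = n - t \<and>
        T \<inter> A = {} \<and> S \<subseteq> A \<and>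
        V = T \<union> A \<and>
        E = nsets A r \<union> {{x} \<union> R | x R. x \<in> T \<and> R \<in> nsets S (r - 1)})"

text \<open>
  The parameter \<open>t\<close> attached to \<open>k\<close> is well defined. The case \<open>t = 0\<close>, where \<open>t - 1\<close> would truncate,
  is excluded by \<open>k \<le> t choose (r - 1)\<close>.
\<close>

lemma ex1_parameter:
  fixes r k :: nat
  assumes "r \<ge> 2" "k \<ge> 1"
  shows "\<exists>!t. ((t - 1) choose (r - 1)) < k \<and> k \<le> (t choose (r - 1))"
proof -
  have big: "k \<le> ((k + r) choose (r - 1))"
  proof -
    have "Suc m \<le> ((m + j + 1) choose j)" if "j \<ge> 1" for m j :: nat
      using that
    proof (induction m)
      case (Suc m)
      obtain i where i: "j = Suc i" using Suc.prems by (cases j) auto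
      have "1 \<le> ((Suc m + j) choose i)" using i by (simp add: Suc_le_eq)
      moreover have "((Suc m + j + 1) choose j) = ((Suc m + j) choose i) + ((m + j + 1) choose j)"
        by (simp add: i)
      ultimately show ?case using Suc by linarith
    qed simp
    from this[of "r - 1" k] have "Suc k \<le> ((k + (r - 1) + 1) choose (r - 1))"
      using assms by simp
    moreover have "k + (r - 1) + 1 = k + r" using assms by simp
    ultimately show ?thesis by simp
  qed
  define t where "t = (LEAST t. k \<le> (t choose (r - 1)))"
  have t1: "k \<le> (t choose (r - 1))" unfolding t_def using big by (rule LeastI)
  have "t \<noteq> 0" using t1 assms by (cases "t = 0") (auto simp: binomial_eq_0)
  then have t2: "((t - 1) choose (r - 1)) < k"
    using not_less_Least[of "t - 1" "\<lambda>t. k \<le> (t choose (r - 1))"] unfolding t_def by auto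
  have uniq: "u \<le> v"
    if "((u - 1) choose (r - 1)) < k" "k \<le> (v choose (r - 1))" for u v :: nat
  proof (rule ccontr)
    assume "\<not> u \<le> v"
    then have "v \<le> u - 1" by simp
    then have "(v choose (r - 1)) \<le> ((u - 1) choose (r - 1))" by (rule binomial_right_mono)
    with that show False by simp
  qed
  show ?thesis using t1 t2 uniq by (metis le_antisym)
qed

end

theory Submission
  imports Defs
begin

text \<open>
  Write \<open>m = (n - 1) div 2\<close>. The bound follows from a rotation argument in the style of
  Posa, combined with a count of the hyperedges that meet the set of reachable path starts.

  Adding hyperedges keeps the hypotheses until a Hamiltonian Berge cycle is about to appear, so
  there is a Hamiltonian Berge path \<open>v 0, \<dots>, v N\<close> with \<open>N = n - 1\<close> and hyperedges
  \<open>e 0, \<dots>, e (N - 1)\<close>; call the other hyperedges free. If a free hyperedge contains \<open>v 0\<close> and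
  \<open>v (Suc i)\<close>, or if \<open>e i\<close> contains \<open>v 0\<close>, then the initial segment up to \<open>v i\<close> can be turned
  round and \<open>v i\<close> becomes the first vertex. Fix the last vertex \<open>z\<close> and the set of path
  hyperedges at \<open>z\<close>, and let \<open>R\<close>, of size \<open>s\<close>, be the set of all starts of such paths. Since
  there is no Hamiltonian Berge cycle, rotations do not leave this class, and no vertex of \<open>R\<close>
  lies in a free hyperedge at \<open>z\<close> (\<open>rotate_free\<close>, \<open>starts_from_end_le\<close>). The degree of a start
  is at most \<open>(a choose (r - 1)) + b\<close>, where \<open>a\<close> and \<open>b\<close> count the two kinds of rotations, and
  both are at most \<open>s\<close>.

  Suppose first that some class has \<open>s \<le> m\<close>. A start whose degree exceeds \<open>s choose (r - 1)\<close>
  lies in many hyperedges with a second start. Charging these hyperedges by halves shows that at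
  most \<open>s * (s choose (r - 1))\<close> hyperedges meet \<open>R\<close>, so \<open>card E \<le> g r n s\<close>
  (\<open>card_edges_le_g\<close>). Moreover some start has degree at most \<open>s choose (r - 1)\<close>
  (\<open>exists_low_degree_start\<close>), so the minimum degree gives \<open>t \<le> s\<close>. As \<open>g r n\<close> is convex, its
  value at \<open>s\<close> is at most the larger of the values at \<open>t\<close> and \<open>m\<close>.

  Suppose now that \<open>s > m\<close> for all classes. The starts of the paths that run in the opposite
  direction and the free neighbours of \<open>v 0\<close> are disjoint, so \<open>a < N - m\<close> for every path. If a
  path has \<open>m\<close> rotations, the resulting starts share its \<open>N\<close> hyperedges, which need to be counted
  only once (\<open>card_edges_meeting_turns\<close>); otherwise the degrees of the starts are small. For odd
  \<open>n\<close>, and for even \<open>n\<close> if always \<open>a < m\<close>, this gives \<open>g r n m\<close>. The remaining case is \<open>n\<close> even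
  with a class of exactly \<open>m + 1\<close> starts, where the same two counts, done on all \<open>m + 1\<close> starts,
  give the extra summand \<open>m\<close> (\<open>card_edges_le_of_smallest_class\<close>).

  The extremal hypergraphs have no Hamiltonian Berge cycle because the cycle would have to
  alternate between \<open>T\<close> and \<open>S\<close> and could not reach the other vertices.
\<close>

section \<open>Binomial coefficients\<close>

lemma binomial_ge_top:
  fixes x j :: nat
  assumes "1 \<le> j" "j < x"
  shows "x \<le> x choose j"
  using assms
proof (induction x arbitrary: j)
  case (Suc x)
  obtain i where i: "j = Suc i" using Suc.prems by (cases j) auto
  have eq: "(Suc x choose j) = (x choose i) + (x choose j)" by (simp add: i)
  have pos: "1 \<le> x choose i" using Suc.prems i by (simp add: Suc_le_eq)
  show ?case
  proof (cases "j < x")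
    case True
    then show ?thesis using Suc.IH[of j] Suc.prems pos eq by linarith
  next
    case False
    then have "j = x" using Suc.prems by simp
    then show ?thesis using i by (metis binomial_Suc_n le_refl)
  qed
qed simp

lemma binomial_pascal:
  fixes x r :: nat
  assumes "1 \<le> x" "2 \<le> r"
  shows "x choose (r - 1) = ((x - 1) choose (r - 1)) + ((x - 1) choose (r - 2))"
proof -
  obtain y where "x = Suc y" using assms by (cases x) auto
  moreover obtain q where "r = Suc (Suc q)" using assms by (metis add_2_eq_Suc le_Suc_ex)
  ultimately show ?thesis by simp
qed

lemma binomial_step_ge:
  fixes s r :: nat
  assumes "3 \<le> r" "r \<le> s"
  shows "((s - 1) choose (r - 1)) + (s - 1) \<le> s choose (r - 1)"
proof -
  have "s - 1 \<le> (s - 1) choose (r - 2)" by (rule binomial_ge_top) (use assms in auto)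
  then show ?thesis using binomial_pascal[of s r] assms by linarith
qed

text \<open>
  Both summands have increasing differences; for the second one this is a product rule.
\<close>

lemma g_convex:
  fixes n r s :: nat
  assumes "2 \<le> r" "Suc (Suc s) \<le> n"
  shows "2 * g r n (Suc s) \<le> g r n s + g r n (Suc (Suc s))"
proof -
  obtain q where r: "r = Suc (Suc q)" using assms by (metis add_2_eq_Suc le_Suc_ex)
  obtain j where n: "n = Suc (Suc s) + j" using assms le_Suc_ex by blast
  have d: "n - s = Suc (Suc j)" "n - Suc s = Suc j" "n - Suc (Suc s) = j"
    using n by auto
  have 1: "2 * (Suc j choose r) \<le> (Suc (Suc j) choose r) + (j choose r)"
    by (simp add: r)
  let ?b = "\<lambda>x. x choose (r - 1)"
  have 2: "2 * ?b (Suc s) \<le> ?b s + ?b (Suc (Suc s))" by (cases q) (simp_all add: r)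
  have 3: "?b s \<le> ?b (Suc (Suc s))" by (simp add: r)
  have "Suc s * (2 * ?b (Suc s)) \<le> Suc s * (?b s + ?b (Suc (Suc s)))" using 2 by (rule mult_le_mono2)
  then have "2 * (Suc s * ?b (Suc s)) \<le> s * ?b s + Suc (Suc s) * ?b (Suc (Suc s))"
    using 3 by (simp add: algebra_simps)
  moreover have "2 * (w + x) \<le> (a + b) + (c + d)" if "2 * w \<le> a + c" "2 * x \<le> b + d"
    for a b c d w x :: nat using add_mono[OF that] by (simp add: algebra_simps)
  ultimately show ?thesis using 1 unfolding g_def d by blast
qed

lemma g_le_max_endpoints:
  fixes n r s a b :: nat
  assumes r: "2 \<le> r" and "a \<le> s" "s \<le> b" and b: "b \<le> n"
  shows "g r n s \<le> max (g r n a) (g r n b)"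
proof (rule ccontr)
  assume neg: "\<not> ?thesis"
  \<comment> \<open>As the differences increase, an ascent at a point left of \<open>s\<close> persists up to \<open>b\<close>.\<close>
  have up: "g r n (Suc x) \<le> g r n (Suc (Suc x))" if "g r n x \<le> g r n (Suc x)" "Suc (Suc x) \<le> n" for x
    using g_convex[OF r that(2)] that(1) by linarith
  have "\<exists>x. a \<le> x \<and> x < s \<and> g r n x \<le> g r n (Suc x)"
  proof (rule ccontr)
    assume no: "\<not> ?thesis"
    have "g r n s \<le> g r n a"
      using \<open>a \<le> s\<close> no
    proof (induction s rule: dec_induct)
      case (step x)
      then show ?case by (metis le_trans less_Suc_eq linear)
    qed simp
    then show False using neg by simp
  qed
  then obtain x where x: "x < s" "g r n x \<le> g r n (Suc x)" by blast
  have mono: "Suc y \<le> b \<Longrightarrow> g r n y \<le> g r n (Suc y)" if "x \<le> y" for y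
    using that
  proof (induction y rule: dec_induct)
    case base
    then show ?case using x by simp
  next
    case (step y)
    then show ?case using up[of y] b by simp
  qed
  have "g r n s \<le> g r n b"
    using \<open>s \<le> b\<close>
  proof (induction rule: dec_induct)
    case base
    then show ?case by simp
  next
    case (step y)
    then show ?case using mono[of y] x by simp
  qed
  then show False using neg by simp
qed

section \<open>Rotations of Hamiltonian Berge paths\<close>

definition ham_path :: "'a set \<Rightarrow> 'a set set \<Rightarrow> nat \<Rightarrow> (nat \<Rightarrow> 'a) \<Rightarrow> (nat \<Rightarrow> 'a set) \<Rightarrow> bool" where
  "ham_path V E N v e \<longleftrightarrow> bij_betw v {..N} V \<and> inj_on e {..<N} \<and>
     (\<forall>i<N. e i \<in> E \<and> v i \<in> e i \<and> v (Suc i) \<in> e i)"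

definition rot_vertices :: "nat \<Rightarrow> (nat \<Rightarrow> 'a) \<Rightarrow> nat \<Rightarrow> 'a" where
  "rot_vertices i v = (\<lambda>j. if j \<le> i then v (i - j) else v j)"

definition rot_edges :: "nat \<Rightarrow> 'a set \<Rightarrow> (nat \<Rightarrow> 'a set) \<Rightarrow> nat \<Rightarrow> 'a set" where
  "rot_edges i f e = (\<lambda>j. if j < i then e (i - Suc j) else if j = i then f else e j)"

lemma rot_edges_image:
  assumes "i < N"
  shows "rot_edges i f e ` {..<N} = insert f (e ` ({..<N} - {i}))"
proof
  show "rot_edges i f e ` {..<N} \<subseteq> insert f (e ` ({..<N} - {i}))"
    using assms by (auto simp: rot_edges_def)
  show "insert f (e ` ({..<N} - {i})) \<subseteq> rot_edges i f e ` {..<N}"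
  proof
    fix h assume "h \<in> insert f (e ` ({..<N} - {i}))"
    then consider "h = f" | j where "h = e j" "j < N" "j < i" | j where "h = e j" "j < N" "j > i"
      using nat_neq_iff by auto
    then show "h \<in> rot_edges i f e ` {..<N}"
    proof cases
      case 1
      then show ?thesis using assms by (auto simp: rot_edges_def intro!: image_eqI[of _ _ i])
    next
      case (2 j)
      then show ?thesis using assms
        by (auto simp: rot_edges_def intro!: image_eqI[of _ _ "i - Suc j"])
    next
      case (3 j)
      then show ?thesis by (auto simp: rot_edges_def intro!: image_eqI[of _ _ j])
    qed
  qed
qed

text \<open>
  If \<open>f\<close> contains the first vertex and the vertex after position \<open>i\<close>, then turning round the
  initial segment up to \<open>i\<close> and linking it by \<open>f\<close> gives a path that starts at \<open>v i\<close> and no longer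
  needs \<open>e i\<close>. The choice \<open>f = e i\<close> is allowed.
\<close>

lemma ham_path_rotate:
  assumes P: "ham_path V E N v e" and i: "i < N"
    and f: "f \<in> E" "v 0 \<in> f" "v (Suc i) \<in> f" "f \<notin> e ` ({..<N} - {i})"
  shows "ham_path V E N (rot_vertices i v) (rot_edges i f e)"
proof -
  have inj_s: "inj_on (\<lambda>j. if j \<le> i then i - j else j) {..N}"
    by (auto simp: inj_on_def split: if_splits)
  have "(\<lambda>j. if j \<le> i then i - j else j) ` {..N} = {..N}"
    by (rule endo_inj_surj) (use i inj_s in auto)
  then have "bij_betw (\<lambda>j. if j \<le> i then i - j else j) {..N} {..N}"
    using inj_s by (simp add: bij_betw_def)
  moreover have "rot_vertices i v = v \<circ> (\<lambda>j. if j \<le> i then i - j else j)"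
    by (auto simp: rot_vertices_def)
  ultimately have bv: "bij_betw (rot_vertices i v) {..N} V"
    using P by (simp add: ham_path_def bij_betw_trans)
  have ie: "inj_on e {..<N}" using P by (simp add: ham_path_def)
  have "card (e ` ({..<N} - {i})) = N - 1"
    using inj_on_subset[OF ie, of "{..<N} - {i}"] i by (simp add: card_image)
  then have "card (rot_edges i f e ` {..<N}) = card {..<N}"
    unfolding rot_edges_image[OF i] using f(4) i by simp
  then have "inj_on (rot_edges i f e) {..<N}" by (intro eq_card_imp_inj_on) auto
  moreover have "rot_edges i f e j \<in> E \<and> rot_vertices i v j \<in> rot_edges i f e j \<and>
      rot_vertices i v (Suc j) \<in> rot_edges i f e j" if j: "j < N" for j
  proof -
    have e: "e a \<in> E \<and> v a \<in> e a \<and> v (Suc a) \<in> e a" if "a < N" for a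
      using P that by (simp add: ham_path_def)
    consider "j < i" | "j = i" | "j > i" by linarith
    then show ?thesis
    proof cases
      case 1
      then have "Suc (i - Suc j) = i - j" by simp
      then show ?thesis using e[of "i - Suc j"] 1 i by (auto simp: rot_edges_def rot_vertices_def)
    next
      case 2
      then show ?thesis using f by (auto simp: rot_edges_def rot_vertices_def)
    next
      case 3
      then show ?thesis using e[OF j] by (auto simp: rot_edges_def rot_vertices_def)
    qed
  qed
  ultimately show ?thesis using bv by (simp add: ham_path_def)
qed

lemma ham_path_reverse:
  assumes P: "ham_path V E N v e"
  shows "ham_path V E N (\<lambda>j. v (N - j)) (\<lambda>j. e (N - Suc j))"
    and "(\<lambda>j. e (N - Suc j)) ` {..<N} = e ` {..<N}"
proof -
  have b: "bij_betw (\<lambda>j. N - j) {..N} {..N}"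
    by (rule bij_betwI[where g = "\<lambda>j. N - j"]) auto
  have c: "bij_betw (\<lambda>j. N - Suc j) {..<N} {..<N}"
    by (rule bij_betwI[where g = "\<lambda>j. N - Suc j"]) auto
  have ie: "inj_on (e \<circ> (\<lambda>j. N - Suc j)) {..<N}"
    using P c by (intro comp_inj_on) (auto simp: ham_path_def bij_betw_def)
  have bv: "bij_betw (v \<circ> (\<lambda>j. N - j)) {..N} V"
    using P b by (auto simp: ham_path_def intro: bij_betw_trans)
  have "e (N - Suc j) \<in> E \<and> v (N - j) \<in> e (N - Suc j) \<and> v (N - Suc j) \<in> e (N - Suc j)"
    if "j < N" for j
  proof -
    have "N - Suc j < N" "Suc (N - Suc j) = N - j" using that by auto
    then show ?thesis using P unfolding ham_path_def by metis
  qed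
  then show "ham_path V E N (\<lambda>j. v (N - j)) (\<lambda>j. e (N - Suc j))"
    using ie bv by (simp add: ham_path_def comp_def)
  show "(\<lambda>j. e (N - Suc j)) ` {..<N} = e ` {..<N}"
    using c by (metis bij_betw_imp_surj_on image_image)
qed

lemma ham_path_close:
  assumes P: "ham_path V E N v e" and f: "f \<in> E" "f \<notin> e ` {..<N}" "v 0 \<in> f" "v N \<in> f"
  shows "has_berge_hamiltonian_cycle V E"
proof -
  let ?e = "\<lambda>i. if i = N then f else e i"
  let ?vs = "map v [0..<Suc N]" and ?es = "map ?e [0..<Suc N]"
  have nth: "?vs ! i = v i" "?es ! i = ?e i" if "i < Suc N" for i
    using that by (simp_all del: upt_Suc)
  have iv: "inj_on v {..N}" "v ` {..N} = V" and ie: "inj_on e {..<N}"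
    and e: "\<And>a. a < N \<Longrightarrow> e a \<in> E \<and> v a \<in> e a \<and> v (Suc a) \<in> e a"
    using P by (auto simp: ham_path_def bij_betw_def)
  have "inj_on ?e {..N}"
    using ie f(2) by (auto simp: inj_on_def le_less image_iff)
  then have "inj_on ?e {0..<Suc N}" by (simp add: atLeast0LessThan lessThan_Suc_atMost)
  then have des: "distinct ?es" by (simp add: distinct_map del: upt_Suc)
  have dvs: "distinct ?vs" and svs: "set ?vs = V"
    using iv by (simp_all add: distinct_map atLeast0LessThan lessThan_Suc_atMost del: upt_Suc)
  have ses: "set ?es \<subseteq> E" using e f(1) by auto
  have "?vs ! i \<in> ?es ! i \<and> ?vs ! ((i + 1) mod length ?vs) \<in> ?es ! i" if i: "i < length ?vs" for i
  proof (cases "i = N")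
    case True
    then show ?thesis using f nth[of N] nth[of 0] by (simp del: upt_Suc)
  next
    case False
    then have "i < N" using i by simp
    then show ?thesis using e[of i] nth[of i] nth[of "Suc i"] by (simp del: upt_Suc)
  qed
  then have "berge_cycle E ?vs ?es"
    unfolding berge_cycle_def using des dvs ses by (simp del: upt_Suc)
  then show ?thesis using svs unfolding has_berge_hamiltonian_cycle_def by blast
qed

lemma add_mod_inj:
  fixes a b i n :: nat
  assumes "(i + a) mod n = (i + b) mod n" "a < n" "b < n"
  shows "a = b"
proof -
  have "a = b" if "(i + a) mod n = (i + b) mod n" "a \<le> b" "b < n" for a b :: nat
  proof -
    have "n dvd (i + b) - (i + a)" using that mod_eq_dvd_iff_nat[of "i + a" "i + b" n] by simp
    then have "n dvd b - a" by simp
    then show ?thesis using that by (metis diff_is_0_eq dvd_imp_le le_antisym less_imp_diff_less not_le zero_less_iff_neq_zero)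
  qed
  from this[of a b] this[of b a] show ?thesis using assms by linarith
qed

section \<open>Existence of Hamiltonian Berge paths\<close>

text \<open>
  The cyclic intervals of length \<open>r\<close> serve as hyperedges. They are distinct because the first
  point of an interval is its only point whose predecessor lies outside.
\<close>

lemma complete_has_ham_cycle:
  assumes "finite V" and n: "card V = n" and r: "2 \<le> r" "r < n"
  shows "has_berge_hamiltonian_cycle V (nsets V r)"
proof -
  obtain h where h: "bij_betw h {0..<n} V"
    using ex_bij_betw_nat_finite[OF assms(1)] n by blast
  have inj: "inj_on h {0..<n}" and im: "h ` {0..<n} = V" using h by (auto simp: bij_betw_def)
  define I where "I = (\<lambda>i. (\<lambda>j. (i + j) mod n) ` {0..<r})"
  define ed where "ed = (\<lambda>i. h ` I i)"
  have n0: "0 < n" using r by simp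
  have Isub: "I i \<subseteq> {0..<n}" for i using n0 by (auto simp: I_def)
  have injI: "inj_on (\<lambda>j. (i + j) mod n) {0..<r}" for i
  proof (rule inj_onI)
    fix a b assume ab: "a \<in> {0..<r}" "b \<in> {0..<r}" "(i + a) mod n = (i + b) mod n"
    then show "a = b" using add_mod_inj[of i a n b] r by simp
  qed
  have cI: "card (I i) = r" for i using injI[of i] by (simp add: I_def card_image)
  have ded: "ed i \<in> nsets V r" for i
    using Isub[of i] cI[of i] im inj unfolding ed_def nsets_def
    by (auto simp: I_def card_image inj_on_subset)
  have first: "(i + (n - 1)) mod n \<notin> I i" for i
  proof
    assume "(i + (n - 1)) mod n \<in> I i"
    then obtain j where j: "j < r" "(i + (n - 1)) mod n = (i + j) mod n" by (auto simp: I_def)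
    then have "n - 1 = j" using add_mod_inj[of i "n - 1" n j] r by simp
    then show False using j(1) r by simp
  qed
  have Iinj: "i = k" if ik: "i < n" "k < n" "I i = I k" for i k
  proof (rule ccontr)
    assume ne: "i \<noteq> k"
    have "i \<in> I i" using ik(1) r by (auto simp: I_def intro!: image_eqI[of _ _ 0])
    then have "i \<in> I k" using ik(3) by simp
    then obtain j where j: "j < r" "i = (k + j) mod n" using ik by (auto simp: I_def)
    have j0: "j \<noteq> 0" using j(2) ne ik(2) by (metis add_0_right mod_less)
    have "(i + (n - 1)) mod n = (k + j + (n - 1)) mod n" using j(2) by (simp add: mod_add_left_eq)
    also have "k + j + (n - 1) = (k + (j - 1)) + n" using j0 n0 by simp
    finally have "(i + (n - 1)) mod n = (k + (j - 1)) mod n" by simp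
    moreover have "(k + (j - 1)) mod n \<in> I k" using j(1) by (auto simp: I_def)
    ultimately show False using first[of i] ik(3) by simp
  qed
  have "inj_on ed {0..<n}"
    using Iinj inj Isub unfolding ed_def
    by (metis (no_types, lifting) atLeastLessThan_iff inj_onI inj_on_image_eq_iff)
  let ?vs = "map h [0..<n]" and ?es = "map ed [0..<n]"
  have "?vs ! i \<in> ?es ! i \<and> ?vs ! ((i + 1) mod length ?vs) \<in> ?es ! i" if "i < length ?vs" for i
  proof -
    have i: "i < n" using that by simp
    have "i \<in> I i" using i r by (auto simp: I_def intro!: image_eqI[of _ _ 0])
    moreover have "(i + 1) mod n \<in> I i" using r by (auto simp: I_def intro!: image_eqI[of _ _ 1])
    ultimately show ?thesis using i n0 by (auto simp: ed_def)
  qed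
  then have "berge_cycle (nsets V r) ?vs ?es"
    unfolding berge_cycle_def using inj \<open>inj_on ed {0..<n}\<close> ded n0
    by (auto simp: distinct_map)
  moreover have "set ?vs = V" using im by simp
  ultimately show ?thesis unfolding has_berge_hamiltonian_cycle_def by blast
qed

lemma ham_path_of_added_edge:
  assumes ham: "has_berge_hamiltonian_cycle V (insert f E)"
    and non: "\<not> has_berge_hamiltonian_cycle V E" and V: "card V = Suc N"
  shows "\<exists>v e. ham_path V E N v e"
proof -
  obtain vs es where c: "berge_cycle (insert f E) vs es" and sv: "set vs = V"
    using ham unfolding has_berge_hamiltonian_cycle_def by blast
  have len: "length es = length vs" and dv: "distinct vs" and de: "distinct es"
    and se: "set es \<subseteq> insert f E"
    and inc: "\<And>i. i < length vs \<Longrightarrow> vs ! i \<in> es ! i \<and> vs ! ((i + 1) mod length vs) \<in> es ! i"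
    using c by (auto simp: berge_cycle_def)
  have lv: "length vs = Suc N" using distinct_card[OF dv] sv V by simp
  have "f \<in> set es"
  proof (rule ccontr)
    assume "f \<notin> set es"
    then have "berge_cycle E vs es" using c se unfolding berge_cycle_def by blast
    then show False using non sv unfolding has_berge_hamiltonian_cycle_def by blast
  qed
  then obtain j where j: "j < Suc N" "es ! j = f" using len lv by (metis in_set_conv_nth)
  define p where "p = (\<lambda>i. (j + 1 + i) mod Suc N)"
  have pb: "p i < Suc N" for i by (simp add: p_def)
  have pinj: "inj_on p {..N}"
  proof (rule inj_onI)
    fix a b assume ab: "a \<in> {..N}" "b \<in> {..N}" "p a = p b"
    then show "a = b" using add_mod_inj[of "j + 1" a "Suc N" b] by (simp add: p_def)
  qed
  have pim: "p ` {..N} = {..N}"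
    by (rule endo_inj_surj) (use pb pinj in \<open>auto simp: less_Suc_eq_le\<close>)
  have psuc: "p (Suc i) = (p i + 1) mod Suc N" for i
    by (simp add: p_def mod_Suc_eq)
  have "j + 1 + N = j + Suc N" by simp
  then have pN: "p N = j" using j unfolding p_def by (metis mod_add_self2 mod_less)
  have vsb: "bij_betw (\<lambda>i. vs ! i) {..N} V"
    using bij_betw_nth[OF dv, of "{..<length vs}" V] sv lv by (simp add: lessThan_Suc_atMost)
  then have 1: "bij_betw (\<lambda>i. vs ! p i) {..N} V"
    using bij_betw_trans[of p "{..N}" "{..N}" "\<lambda>i. vs ! i" V] pinj pim
    by (simp add: bij_betw_def comp_def)
  have 2: "inj_on (\<lambda>i. es ! p i) {..<N}"
  proof (rule inj_onI)
    fix a b assume ab: "a \<in> {..<N}" "b \<in> {..<N}" "es ! p a = es ! p b"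
    then have "p a = p b" using de len lv pb by (simp add: nth_eq_iff_index_eq)
    then show "a = b" using ab pinj by (auto dest: inj_onD)
  qed
  have 3: "es ! p i \<in> E \<and> vs ! p i \<in> es ! p i \<and> vs ! p (Suc i) \<in> es ! p i" if i: "i < N" for i
  proof -
    have "p i \<noteq> p N" using pinj i by (auto dest: inj_onD)
    then have "es ! p i \<noteq> f" using pN j de len lv pb by (metis nth_eq_iff_index_eq)
    moreover have "es ! p i \<in> set es" using len lv pb by simp
    ultimately have "es ! p i \<in> E" using se by blast
    then show ?thesis using inc[of "p i"] lv pb psuc by simp
  qed
  show ?thesis
    by (rule exI[of _ "\<lambda>i. vs ! p i"], rule exI[of _ "\<lambda>i. es ! p i"])
      (use 1 2 3 in \<open>auto simp: ham_path_def\<close>)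
qed

text \<open>
  Adding hyperedges one by one to a hypergraph without Hamiltonian Berge cycle creates such a
  cycle at some moment; just before, there is a Hamiltonian Berge path.
\<close>

lemma nonhamiltonian_extension_with_ham_path:
  assumes fin: "finite V" and V: "card V = Suc N" and r: "2 \<le> r" "r \<le> N"
    and E: "E \<subseteq> nsets V r" and non: "\<not> has_berge_hamiltonian_cycle V E"
  obtains E' v e where "E \<subseteq> E'" "E' \<subseteq> nsets V r" "\<not> has_berge_hamiltonian_cycle V E'"
    "ham_path V E' N v e"
proof -
  let ?S = "{E'. E \<subseteq> E' \<and> E' \<subseteq> nsets V r \<and> \<not> has_berge_hamiltonian_cycle V E'}"
  have fn: "finite (nsets V r)" using fin by (simp add: finite_imp_finite_nsets)
  have "finite ?S" by (rule finite_subset[of _ "Pow (nsets V r)"]) (use fn in auto)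
  moreover have "E \<in> ?S" using E non by simp
  ultimately obtain E' where E': "E' \<in> ?S" and mx: "\<And>G. G \<in> ?S \<Longrightarrow> E' \<subseteq> G \<Longrightarrow> G = E'"
    using finite_has_maximal[of ?S] by (metis (lifting) empty_iff)
  have "E' \<noteq> nsets V r" using complete_has_ham_cycle[OF fin V] r E' by auto
  then obtain f where f: "f \<in> nsets V r" "f \<notin> E'" using E' by blast
  then have "has_berge_hamiltonian_cycle V (insert f E')" using mx[of "insert f E'"] E' by blast
  then obtain v e where "ham_path V E' N v e"
    using ham_path_of_added_edge[of V f E' N] E' V by blast
  then show thesis using that[of E' v e] E' by blast
qed

section \<open>Counting hyperedges\<close>

lemma card_edges_at_le:
  assumes "finite W" and "1 \<le> r" and S: "\<And>f. f \<in> S \<Longrightarrow> x \<in> f \<and> card f = r \<and> f - {x} \<subseteq> W"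
  shows "card S \<le> card W choose (r - 1)"
proof -
  have inj: "inj_on (\<lambda>f. f - {x}) S"
    by (rule inj_onI) (metis S insert_Diff)
  have "(\<lambda>f. f - {x}) ` S \<subseteq> {B. B \<subseteq> W \<and> card B = r - 1}"
  proof
    fix B assume "B \<in> (\<lambda>f. f - {x}) ` S"
    then obtain f where f: "f \<in> S" "B = f - {x}" by blast
    have "x \<in> f" "card f = r" "B \<subseteq> W" using S[OF f(1)] f(2) by auto
    then show "B \<in> {B. B \<subseteq> W \<and> card B = r - 1}" using f(2) by (simp add: card_Diff_singleton)
  qed
  then have "card ((\<lambda>f. f - {x}) ` S) \<le> card {B. B \<subseteq> W \<and> card B = r - 1}"
    by (rule card_mono[rotated]) (use assms(1) in auto)
  then show ?thesis using inj n_subsets[OF assms(1)] by (simp add: card_image)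
qed

lemma card_edges_le_meeting:
  assumes "finite V" "E \<subseteq> nsets V r" "K \<subseteq> V"
  shows "card E \<le> (card V - card K choose r) + card {f \<in> E. f \<inter> K \<noteq> {}}"
proof -
  have fE: "finite E" using assms finite_imp_finite_nsets finite_subset by blast
  have "{f \<in> E. f \<inter> K = {}} \<subseteq> {B. B \<subseteq> V - K \<and> card B = r}"
    using assms(2) by (auto simp: nsets_def)
  then have "card {f \<in> E. f \<inter> K = {}} \<le> card {B. B \<subseteq> V - K \<and> card B = r}"
    by (rule card_mono[rotated]) (use assms(1) in auto)
  also have "\<dots> = card V - card K choose r"
    using n_subsets[of "V - K" r] assms by (simp add: card_Diff_subset finite_subset)
  finally have 1: "card {f \<in> E. f \<inter> K = {}} \<le> card V - card K choose r" .
  have "{f \<in> E. f \<inter> K = {}} \<union> {f \<in> E. f \<inter> K \<noteq> {}} = E" by blast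
  then have "card E \<le> card {f \<in> E. f \<inter> K = {}} + card {f \<in> E. f \<inter> K \<noteq> {}}"
    using card_Un_le[of "{f \<in> E. f \<inter> K = {}}" "{f \<in> E. f \<inter> K \<noteq> {}}"] by simp
  then show ?thesis using 1 by linarith
qed

text \<open>
  A hyperedge with at least two vertices in \<open>K\<close> is counted at each of them, so it suffices
  to charge half of it to each. All quantities are doubled to stay in the natural numbers.
\<close>

lemma card_edges_meeting_by_charging:
  assumes "finite K" "finite E"
    and charge: "\<And>x. x \<in> K \<Longrightarrow> 2 * degree E x \<le> 2 * c + card {f \<in> E. x \<in> f \<and> (\<exists>y\<in>K. y \<in> f \<and> y \<noteq> x)}"
  shows "card {f \<in> E. f \<inter> K \<noteq> {}} \<le> card K * c"
proof -
  let ?M = "{f \<in> E. f \<inter> K \<noteq> {}}"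
  let ?P = "\<lambda>x f. x \<in> f \<and> (\<exists>y\<in>K. y \<in> f \<and> y \<noteq> x)"
  have swap: "(\<Sum>x\<in>K. card {f \<in> E. P x f}) = (\<Sum>f\<in>E. card {x \<in> K. P x f})" for P :: "'a \<Rightarrow> 'a set \<Rightarrow> bool"
    using sum_multicount_gen[OF assms(1,2), of P "\<lambda>f. card {x \<in> K. P x f}"] by blast
  have pt: "2 * (if f \<inter> K \<noteq> {} then 1 else 0) + card {x \<in> K. ?P x f} \<le> 2 * card {x \<in> K. x \<in> f}" for f
  proof -
    define k q where "k = card {x \<in> K. x \<in> f}" and "q = card {x \<in> K. ?P x f}"
    have "q \<le> k" unfolding k_def q_def by (rule card_mono) (use assms(1) in auto)
    moreover have "q = 0" if "k \<le> 1"
    proof -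
      have "{x \<in> K. ?P x f} = {}"
        using that assms(1) by (auto simp: k_def card_le_Suc0_iff_eq)
      then show ?thesis unfolding q_def by (simp only: card.empty)
    qed
    moreover have "1 \<le> k" if "f \<inter> K \<noteq> {}"
      using that assms(1) by (auto simp: k_def Suc_le_eq card_gt_0_iff)
    ultimately have "2 * (if f \<inter> K \<noteq> {} then 1 else 0) + q \<le> 2 * k" by (cases "k \<le> 1") auto
    then show ?thesis by (simp only: k_def q_def)
  qed
  have "2 * card ?M = (\<Sum>f\<in>E. 2 * (if f \<inter> K \<noteq> {} then 1 else 0))"
  proof -
    have "card ?M = (\<Sum>f\<in>E. if f \<inter> K \<noteq> {} then 1 else 0)"
      unfolding sum.inter_filter[OF assms(2), symmetric] by simp
    then show ?thesis by (simp only: sum_distrib_left)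
  qed
  then have "2 * card ?M + (\<Sum>x\<in>K. card {f \<in> E. ?P x f})
      = (\<Sum>f\<in>E. 2 * (if f \<inter> K \<noteq> {} then 1 else 0) + card {x \<in> K. ?P x f})"
    by (simp only: swap[of ?P] sum.distrib)
  also have "\<dots> \<le> (\<Sum>f\<in>E. 2 * card {x \<in> K. x \<in> f})" by (rule sum_mono) (rule pt)
  also have "\<dots> = (\<Sum>x\<in>K. 2 * degree E x)"
    using swap[of "\<lambda>x f. x \<in> f"] by (simp only: sum_distrib_left[symmetric] degree_def)
  also have "\<dots> \<le> (\<Sum>x\<in>K. 2 * c + card {f \<in> E. ?P x f})" by (rule sum_mono) (rule charge)
  also have "\<dots> = 2 * (card K * c) + (\<Sum>x\<in>K. card {f \<in> E. ?P x f})"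
    by (simp add: sum.distrib)
  finally show ?thesis by linarith
qed

section \<open>Classes of paths with a common end\<close>

locale nonhamiltonian =
  fixes V :: "'a set" and E :: "'a set set" and N r :: nat
  assumes fin: "finite V" and cV: "card V = Suc N" and sub: "E \<subseteq> nsets V r"
    and non: "\<not> has_berge_hamiltonian_cycle V E" and r3: "3 \<le> r" and rN: "r \<le> N"
begin

abbreviation path :: "(nat \<Rightarrow> 'a) \<Rightarrow> (nat \<Rightarrow> 'a set) \<Rightarrow> bool" where
  "path \<equiv> ham_path V E N"

definition free :: "(nat \<Rightarrow> 'a set) \<Rightarrow> 'a set set" where
  "free e = E - e ` {..<N}"

text \<open>
  The paths of a class share their last vertex and also the hyperedges at this vertex that they
  use. Every rotation preserves the second property, and it makes the neighbours of \<open>z\<close> through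
  its unused hyperedges unavailable as starts.
\<close>

definition end_class :: "'a \<Rightarrow> 'a set set \<Rightarrow> (nat \<Rightarrow> 'a) \<Rightarrow> (nat \<Rightarrow> 'a set) \<Rightarrow> bool" where
  "end_class z Q v e \<longleftrightarrow> path v e \<and> v N = z \<and> {f \<in> e ` {..<N}. z \<in> f} = Q"

definition starts :: "'a \<Rightarrow> 'a set set \<Rightarrow> 'a set" where
  "starts z Q = {v 0 | v e. end_class z Q v e}"

text \<open>
  An index \<open>i\<close> in one of the next two sets stands for the rotation that turns the segment up to
  \<open>v i\<close> round, either by a free hyperedge or by \<open>e i\<close> itself.
\<close>

definition free_turns :: "(nat \<Rightarrow> 'a) \<Rightarrow> (nat \<Rightarrow> 'a set) \<Rightarrow> nat set" where
  "free_turns v e = {i. i < N \<and> (\<exists>f\<in>free e. v 0 \<in> f \<and> v (Suc i) \<in> f)}"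

definition path_turns :: "(nat \<Rightarrow> 'a) \<Rightarrow> (nat \<Rightarrow> 'a set) \<Rightarrow> nat set" where
  "path_turns v e = {i. i < N \<and> v 0 \<in> e i}"

definition free_deg :: "(nat \<Rightarrow> 'a set) \<Rightarrow> 'a \<Rightarrow> nat" where
  "free_deg e x = card {f \<in> free e. x \<in> f}"

definition start_idx :: "'a \<Rightarrow> 'a set set \<Rightarrow> (nat \<Rightarrow> 'a) \<Rightarrow> nat set" where
  "start_idx z Q v = {i. i < N \<and> v i \<in> starts z Q}"

lemma finE: "finite E"
  using fin sub finite_imp_finite_nsets finite_subset by blast

lemma edgeD:
  assumes "f \<in> E"
  shows "f \<subseteq> V" "card f = r" "finite f"
  using assms sub by (auto simp: nsets_def)

lemma finite_free: "finite (free e)"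
  using finE by (simp add: free_def)

lemma pathD:
  assumes "path v e"
  shows "inj_on v {..N}" "v ` {..N} = V" "inj_on e {..<N}"
    "\<And>i. i < N \<Longrightarrow> e i \<in> E" "\<And>i. i < N \<Longrightarrow> v i \<in> e i" "\<And>i. i < N \<Longrightarrow> v (Suc i) \<in> e i"
  using assms by (auto simp: ham_path_def bij_betw_def)

lemma path_eq_iff:
  assumes "path v e" "i \<le> N" "j \<le> N"
  shows "v i = v j \<longleftrightarrow> i = j"
  using pathD(1)[OF assms(1)] assms by (auto dest: inj_onD)

lemma path_index:
  assumes "path v e" "x \<in> V"
  obtains i where "i \<le> N" "x = v i"
  using pathD(2)[OF assms(1)] assms(2) by auto

lemma class_path: "end_class z Q v e \<Longrightarrow> path v e"
  by (simp add: end_class_def)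

lemma start_in_starts: "end_class z Q v e \<Longrightarrow> v 0 \<in> starts z Q"
  by (auto simp: starts_def)

lemma free_edge_misses_end:
  assumes "path v e" "f \<in> free e" "v 0 \<in> f"
  shows "v N \<notin> f"
  using ham_path_close[of V E N v e f] assms non by (auto simp: free_def)

text \<open>
  If the released hyperedge \<open>e i\<close> contained the last vertex, it would close the rotated path to a
  Hamiltonian Berge cycle; this is why the class is preserved.
\<close>

lemma rotate_free:
  assumes P: "end_class z Q v e" and i: "i < N" and f: "f \<in> free e" "v 0 \<in> f" "v (Suc i) \<in> f"
  shows "end_class z Q (rot_vertices i v) (rot_edges i f e)"
    and "e i \<in> free (rot_edges i f e)" and "z \<notin> e i" and "Suc i < N"
proof -
  have p: "path v e" "v N = z" "{f \<in> e ` {..<N}. z \<in> f} = Q" using P unfolding end_class_def by blast+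
  have f': "f \<in> E" "f \<notin> e ` {..<N}" using f by (auto simp: free_def)
  have zf: "z \<notin> f" using free_edge_misses_end[OF p(1) f(1,2)] p by simp
  show "Suc i < N" using zf p(2) f(3) i by (metis Suc_lessI)
  have rp: "path (rot_vertices i v) (rot_edges i f e)"
    by (rule ham_path_rotate[OF p(1) i]) (use f f' in auto)
  have "e i \<notin> insert f (e ` ({..<N} - {i}))"
    using f' i pathD(3)[OF p(1)] by (auto simp: inj_on_def)
  then show fr: "e i \<in> free (rot_edges i f e)"
    using pathD(4)[OF p(1) i] rot_edges_image[OF i, of f e] by (simp add: free_def)
  show ze: "z \<notin> e i"
    using free_edge_misses_end[OF rp fr] pathD(5)[OF p(1) i] i p(2) by (simp add: rot_vertices_def)
  have "{h \<in> rot_edges i f e ` {..<N}. z \<in> h} = Q"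
    using p(3) zf ze unfolding rot_edges_image[OF i] by blast
  then show "end_class z Q (rot_vertices i v) (rot_edges i f e)"
    using rp p(2) i by (simp add: end_class_def rot_vertices_def)
qed

lemma rotate_path:
  assumes P: "end_class z Q v e" and i: "i \<in> path_turns v e"
  shows "end_class z Q (rot_vertices i v) (rot_edges i (e i) e)"
    and "free (rot_edges i (e i) e) = free e"
proof -
  have p: "path v e" "v N = z" "{f \<in> e ` {..<N}. z \<in> f} = Q" using P unfolding end_class_def by blast+
  have i': "i < N" "v 0 \<in> e i" using i by (auto simp: path_turns_def)
  have "e i \<notin> e ` ({..<N} - {i})" using i' pathD(3)[OF p(1)] by (auto simp: inj_on_def)
  then have rp: "path (rot_vertices i v) (rot_edges i (e i) e)"
    by (intro ham_path_rotate[OF p(1) i'(1)]) (use i' pathD[OF p(1)] in auto)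
  have im: "rot_edges i (e i) e ` {..<N} = e ` {..<N}"
    unfolding rot_edges_image[OF i'(1)] using i' by auto
  show "free (rot_edges i (e i) e) = free e" using im by (simp add: free_def)
  show "end_class z Q (rot_vertices i v) (rot_edges i (e i) e)"
    using rp p i' im unfolding end_class_def by (simp add: rot_vertices_def)
qed

lemma predecessor_is_start:
  assumes "end_class z Q v e" "f \<in> free e" "v 0 \<in> f" "v (Suc i) \<in> f" "i < N"
  shows "v i \<in> starts z Q"
  using start_in_starts[OF rotate_free(1)[OF assms(1,5,2,3,4)]] by (simp add: rot_vertices_def)

lemma path_turn_is_start:
  assumes "end_class z Q v e" "i \<in> path_turns v e"
  shows "v i \<in> starts z Q"
  using start_in_starts[OF rotate_path(1)[OF assms]] by (simp add: rot_vertices_def)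

lemma turns_subset_start_idx:
  assumes "end_class z Q v e"
  shows "free_turns v e \<subseteq> start_idx z Q v" "path_turns v e \<subseteq> start_idx z Q v"
proof -
  show "free_turns v e \<subseteq> start_idx z Q v"
    unfolding free_turns_def start_idx_def using predecessor_is_start[OF assms] by blast
  show "path_turns v e \<subseteq> start_idx z Q v"
    using path_turn_is_start[OF assms] unfolding path_turns_def start_idx_def by blast
qed

lemma zero_path_turn:
  assumes "path v e"
  shows "0 \<in> path_turns v e"
  using pathD(5)[OF assms, of 0] r3 rN by (simp add: path_turns_def)

lemma starts_subset: "starts z Q \<subseteq> V - {z}"
proof
  fix x assume "x \<in> starts z Q"
  then obtain v e where ve: "end_class z Q v e" "x = v 0" by (auto simp: starts_def)
  have p: "path v e" "v N = z" using ve(1) unfolding end_class_def by blast+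
  have "v 0 \<in> v ` {..N}" by simp
  then have "v 0 \<in> V" by (simp only: pathD(2)[OF p(1)])
  moreover have "v 0 \<noteq> v N" using path_eq_iff[OF p(1), of 0 N] r3 rN by simp
  ultimately show "x \<in> V - {z}" using ve p by simp
qed

lemma finite_starts: "finite (starts z Q)"
  using starts_subset fin by (meson finite_Diff finite_subset)

lemma starts_image:
  assumes "end_class z Q v e"
  shows "v ` start_idx z Q v = starts z Q" "card (start_idx z Q v) = card (starts z Q)"
proof -
  have p: "path v e" "v N = z" using assms unfolding end_class_def by blast+
  show im: "v ` start_idx z Q v = starts z Q"
  proof
    show "starts z Q \<subseteq> v ` start_idx z Q v"
    proof
      fix x assume x: "x \<in> starts z Q"
      then have "x \<in> V" "x \<noteq> z" using starts_subset by blast+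
      then obtain i where "i \<le> N" "x = v i" using path_index[OF p(1)] by blast
      then have "i < N" "x = v i" using \<open>x \<noteq> z\<close> p(2) by (auto simp: le_less)
      then show "x \<in> v ` start_idx z Q v" using x by (auto simp: start_idx_def)
    qed
  qed (auto simp: start_idx_def)
  have "inj_on v (start_idx z Q v)"
    using pathD(1)[OF p(1)] by (rule inj_on_subset) (auto simp: start_idx_def)
  then show "card (start_idx z Q v) = card (starts z Q)" using im card_image by fastforce
qed

lemma finite_turns [simp]: "finite (free_turns v e)" "finite (path_turns v e)" "finite (start_idx z Q v)"
  by (auto simp: free_turns_def path_turns_def start_idx_def)

lemma degree_split:
  assumes "path v e"
  shows "degree E (v 0) = free_deg e (v 0) + card (path_turns v e)"
proof -
  have "{f \<in> E. v 0 \<in> f} = {f \<in> free e. v 0 \<in> f} \<union> e ` path_turns v e"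
    using pathD(4)[OF assms] by (auto simp: free_def path_turns_def)
  moreover have "{f \<in> free e. v 0 \<in> f} \<inter> e ` path_turns v e = {}"
    by (auto simp: free_def path_turns_def)
  moreover have "card (e ` path_turns v e) = card (path_turns v e)"
    by (rule card_image, rule inj_on_subset[OF pathD(3)[OF assms]]) (auto simp: path_turns_def)
  ultimately show ?thesis using finite_free
    by (simp add: degree_def free_deg_def card_Un_disjoint)
qed

lemma free_edge_subset:
  assumes p: "path v e" and f: "f \<in> free e" "v 0 \<in> f"
  shows "f - {v 0} \<subseteq> v ` Suc ` free_turns v e"
proof
  fix y assume y: "y \<in> f - {v 0}"
  have "f \<subseteq> V" using edgeD f by (auto simp: free_def)
  then obtain l where l: "l \<le> N" "y = v l" using y path_index[OF p] by blast
  then obtain i where i: "l = Suc i" using y by (cases l) auto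
  then have "i \<in> free_turns v e" using l y f by (auto simp: free_turns_def)
  then show "y \<in> v ` Suc ` free_turns v e" using l i by blast
qed

lemma card_free_nbrs:
  assumes p: "path v e"
  shows "card (v ` Suc ` free_turns v e) = card (free_turns v e)"
proof -
  have "inj_on v (Suc ` free_turns v e)"
    by (rule inj_on_subset[OF pathD(1)[OF p]]) (auto simp: free_turns_def)
  then show ?thesis by (simp add: card_image)
qed

lemma free_deg_le:
  assumes p: "path v e"
  shows "free_deg e (v 0) \<le> card (free_turns v e) choose (r - 1)"
  unfolding free_deg_def card_free_nbrs[OF p, symmetric]
  by (rule card_edges_at_le) (use free_edge_subset[OF p] edgeD r3 in \<open>auto simp: free_def\<close>)

text \<open>
  A hyperedge of the path that lies within the free neighbourhood occupies one of the sets
  counted by the binomial coefficient.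
\<close>

lemma free_deg_less:
  assumes p: "path v e" and h: "j < N" "v 0 \<in> e j" "e j - {v 0} \<subseteq> v ` Suc ` free_turns v e"
  shows "Suc (free_deg e (v 0)) \<le> card (free_turns v e) choose (r - 1)"
proof -
  let ?S = "insert (e j) {f \<in> free e. v 0 \<in> f}"
  have "card ?S \<le> card (v ` Suc ` free_turns v e) choose (r - 1)"
    by (rule card_edges_at_le)
      (use free_edge_subset[OF p] edgeD pathD(4)[OF p h(1)] h r3 in \<open>auto simp: free_def\<close>)
  moreover have "e j \<notin> {f \<in> free e. v 0 \<in> f}" using h(1) by (simp add: free_def)
  ultimately show ?thesis using finite_free card_free_nbrs[OF p] by (simp add: free_deg_def)
qed

lemma path_reverse_class:
  assumes "path v e"
  shows "end_class (v 0) {f \<in> e ` {..<N}. v 0 \<in> f} (\<lambda>j. v (N - j)) (\<lambda>j. e (N - Suc j))"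
  using ham_path_reverse[OF assms] by (simp add: end_class_def)

text \<open>
  For the reversed path the first vertex is the common end of a class. A start of that class which
  is joined to this end by a free hyperedge would close a Hamiltonian Berge cycle.
\<close>

lemma starts_from_end_le:
  assumes p: "path v e"
  shows "card (free_turns v e) + card (starts (v 0) {f \<in> e ` {..<N}. v 0 \<in> f}) \<le> N"
proof -
  let ?Q = "{f \<in> e ` {..<N}. v 0 \<in> f}" and ?W = "v ` Suc ` free_turns v e"
  have disj: "?W \<inter> starts (v 0) ?Q = {}"
  proof (rule ccontr)
    assume "\<not> ?thesis"
    then obtain y where y: "y \<in> ?W" "y \<in> starts (v 0) ?Q" by blast
    obtain f where f: "f \<in> free e" "v 0 \<in> f" "y \<in> f" using y(1) by (auto simp: free_turns_def)
    obtain u c where u: "end_class (v 0) ?Q u c" "y = u 0" using y(2) by (auto simp: starts_def)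
    have c: "path u c" "u N = v 0" "{f \<in> c ` {..<N}. v 0 \<in> f} = ?Q"
      using u(1) unfolding end_class_def by blast+
    have "f \<notin> c ` {..<N}" using c(3) f unfolding free_def by blast
    then have "f \<in> free c" using f(1) unfolding free_def by blast
    then show False using free_edge_misses_end[OF c(1)] u(2) c(2) f by metis
  qed
  have "?W \<subseteq> V - {v 0}"
  proof
    fix y assume "y \<in> ?W"
    then obtain i where i: "i < N" "y = v (Suc i)" by (auto simp: free_turns_def)
    moreover have "v (Suc i) \<in> v ` {..N}" using i by (intro imageI) simp
    ultimately show "y \<in> V - {v 0}" using pathD(2)[OF p] path_eq_iff[OF p, of "Suc i" 0] by simp
  qed
  then have "?W \<union> starts (v 0) ?Q \<subseteq> V - {v 0}" using starts_subset by blast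
  then have "card (?W \<union> starts (v 0) ?Q) \<le> card (V - {v 0})"
    using fin by (intro card_mono) auto
  also have "\<dots> = N" using cV pathD(2)[OF p] by (subst card_Diff_singleton) auto
  finally show ?thesis
    using card_Un_disjoint[OF _ finite_starts disj] card_free_nbrs[OF p] by simp
qed

section \<open>Classes with few starts\<close>

text \<open>
  After the rotation at \<open>i\<close> the hyperedge \<open>e i\<close> is unused and contains the new first vertex, so
  each of its vertices yields a second rotation.
\<close>

lemma released_edge_below:
  assumes P: "end_class z Q v e" and i: "i \<in> free_turns v e" and j: "v j \<in> e i" "j < i"
  shows "v (Suc j) \<in> starts z Q"
proof -
  obtain f where f: "i < N" "f \<in> free e" "v 0 \<in> f" "v (Suc i) \<in> f"
    using i by (auto simp: free_turns_def)
  let ?w = "rot_vertices i v" and ?c = "rot_edges i f e"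
  have C: "end_class z Q ?w ?c" "e i \<in> free ?c" using rotate_free[OF P f] by blast+
  have "?w 0 \<in> e i" using pathD(5)[OF class_path[OF P] f(1)] by (simp add: rot_vertices_def)
  moreover have "?w (Suc (i - Suc j)) \<in> e i" using j by (simp add: rot_vertices_def Suc_diff_Suc)
  ultimately have "?w (i - Suc j) \<in> starts z Q"
    by (rule predecessor_is_start[OF C]) (use f in simp)
  then show ?thesis using j by (simp add: rot_vertices_def)
qed

lemma released_edge_above:
  assumes P: "end_class z Q v e" and i: "i \<in> free_turns v e"
    and j: "v (Suc j) \<in> e i" "i \<le> j" "j < N"
  shows "v j \<in> starts z Q"
proof (cases "i = j")
  case True
  then show ?thesis using turns_subset_start_idx(1)[OF P] i by (auto simp: start_idx_def)
next
  case False
  obtain f where f: "i < N" "f \<in> free e" "v 0 \<in> f" "v (Suc i) \<in> f"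
    using i by (auto simp: free_turns_def)
  let ?w = "rot_vertices i v" and ?c = "rot_edges i f e"
  have C: "end_class z Q ?w ?c" "e i \<in> free ?c" using rotate_free[OF P f] by blast+
  have "?w 0 \<in> e i" using pathD(5)[OF class_path[OF P] f(1)] by (simp add: rot_vertices_def)
  moreover have "?w (Suc j) \<in> e i" using j by (simp add: rot_vertices_def)
  ultimately have "?w j \<in> starts z Q" by (rule predecessor_is_start[OF C]) (rule j(3))
  then show ?thesis using j False by (simp add: rot_vertices_def)
qed

lemma released_edge_misses_end:
  assumes "end_class z Q v e" "i \<in> free_turns v e"
  shows "z \<notin> e i"
  using assms rotate_free(3)[OF assms(1)] by (auto simp: free_turns_def)

text \<open>
  The rotation at \<open>0\<close> leaves the order of the vertices unchanged and only releases \<open>e 0\<close>. So the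
  predecessor of every vertex of \<open>e 0\<close> is a start, and \<open>e 0\<close> lies in the free neighbourhood.
  The index \<open>N - 1\<close> is harmless because \<open>e 0\<close> does not contain the last vertex.
\<close>

lemma first_edge_bound:
  assumes P: "end_class z Q v e" and 0: "0 \<in> free_turns v e"
    and sub: "start_idx z Q v \<subseteq> insert (N - 1) (free_turns v e)"
  shows "Suc (free_deg e (v 0)) \<le> card (free_turns v e) choose (r - 1)"
proof (rule free_deg_less[OF class_path[OF P]])
  have p: "path v e" "v N = z" using P unfolding end_class_def by blast+
  show N0: "0 < N" using r3 rN by simp
  show "v 0 \<in> e 0" using pathD(5)[OF p(1) N0] .
  show "e 0 - {v 0} \<subseteq> v ` Suc ` free_turns v e"
  proof
    fix y assume y: "y \<in> e 0 - {v 0}"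
    have "y \<in> V" using y edgeD(1)[OF pathD(4)[OF p(1) N0]] by blast
    then obtain l where l: "l \<le> N" "y = v l" using path_index[OF p(1)] by blast
    then obtain j where j: "l = Suc j" using y by (cases l) auto
    have "v j \<in> starts z Q"
      by (rule released_edge_above[OF P 0]) (use y l j in auto)
    then have "j \<in> start_idx z Q v" using l j by (simp add: start_idx_def)
    moreover have "j \<noteq> N - 1"
    proof
      assume "j = N - 1"
      then have "l = N" using j N0 by simp
      then show False using released_edge_misses_end[OF P 0] y l p(2) by simp
    qed
    ultimately have "j \<in> free_turns v e" using sub by blast
    then show "y \<in> v ` Suc ` free_turns v e" using l j by blast
  qed
qed

lemma nonzero_path_turn:
  assumes "1 < card (path_turns v e)"
  obtains i where "i \<in> path_turns v e" "0 < i"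
proof (cases "path_turns v e \<subseteq> {0}")
  case True
  then have "card (path_turns v e) \<le> card {0 :: nat}" by (intro card_mono) simp_all
  then show ?thesis using assms by simp
qed (use that in auto)

definition shared :: "'a set \<Rightarrow> 'a \<Rightarrow> 'a set set" where
  "shared K x = {f \<in> E. x \<in> f \<and> (\<exists>y\<in>K. y \<in> f \<and> y \<noteq> x)}"

lemma finite_shared: "finite (shared K x)"
  using finE by (simp add: shared_def)

lemma path_turn_edges_shared:
  assumes P: "end_class z Q v e"
  shows "e ` (path_turns v e - {0}) \<subseteq> shared (starts z Q) (v 0)"
proof
  fix f assume "f \<in> e ` (path_turns v e - {0})"
  then obtain i where i: "i \<in> path_turns v e" "i \<noteq> 0" "f = e i" by blast
  have iN: "i < N" "v 0 \<in> e i" using i by (auto simp: path_turns_def)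
  have p: "path v e" by (rule class_path[OF P])
  have "v i \<noteq> v 0" using path_eq_iff[OF p, of i 0] i iN by simp
  then show "f \<in> shared (starts z Q) (v 0)"
    using path_turn_is_start[OF P i(1)] pathD(4,5)[OF p iN(1)] iN i by (auto simp: shared_def)
qed

lemma card_path_turns_le_shared:
  assumes P: "end_class z Q v e"
  shows "card (path_turns v e) \<le> Suc (card (shared (starts z Q) (v 0)))"
proof -
  have "card (e ` (path_turns v e - {0})) = card (path_turns v e - {0})"
    by (rule card_image, rule inj_on_subset[OF pathD(3)[OF class_path[OF P]]])
      (auto simp: path_turns_def)
  moreover have "card (path_turns v e - {0}) = card (path_turns v e) - 1"
    by (rule card_Diff_singleton) (rule zero_path_turn[OF class_path[OF P]])
  ultimately show ?thesis
    using card_mono[OF finite_shared path_turn_edges_shared[OF P]] by linarith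
qed

text \<open>
  If some \<open>e i\<close> with \<open>i > 0\<close> contains the first vertex and is released by a free rotation, then
  the second vertex is a start. Hence the first edge of the path and all free hyperedges
  through the second vertex are shared as well.
\<close>

lemma shared_ge_with_second_vertex:
  assumes P: "end_class z Q v e" and 0: "0 \<in> free_turns v e"
    and i: "i \<in> path_turns v e" "i \<in> free_turns v e" "0 < i"
  shows "card (path_turns v e) + free_deg e (v 0)
    \<le> card (shared (starts z Q) (v 0)) + (card (free_turns v e) - 1 choose (r - 1))"
proof -
  let ?W = "v ` Suc ` free_turns v e"
  have p: "path v e" by (rule class_path[OF P])
  have N0: "0 < N" using r3 rN by simp
  have v1: "v 1 \<in> starts z Q"
    using released_edge_below[OF P i(2), of 0] i by (auto simp: path_turns_def)
  have ne: "v 1 \<noteq> v 0" using path_eq_iff[OF p, of 1 0] N0 by simp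
  let ?S = "{f \<in> free e. v 0 \<in> f \<and> v 1 \<in> f}" and ?T = "{f \<in> free e. v 0 \<in> f \<and> v 1 \<notin> f}"
  have fd: "free_deg e (v 0) = card ?S + card ?T"
  proof -
    have "{f \<in> free e. v 0 \<in> f} = ?S \<union> ?T" by blast
    moreover have "card (?S \<union> ?T) = card ?S + card ?T"
      by (rule card_Un_disjoint) (use finite_free in auto)
    ultimately show ?thesis by (simp add: free_deg_def)
  qed
  have "card ?T \<le> card (?W - {v 1}) choose (r - 1)"
    by (rule card_edges_at_le[where x = "v 0"])
      (use free_edge_subset[OF p] edgeD r3 in \<open>auto simp: free_def\<close>)
  moreover have "v 1 \<in> ?W" using 0 by (metis One_nat_def imageI)
  then have "card (?W - {v 1}) = card (free_turns v e) - 1"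
    using card_free_nbrs[OF p] by (simp add: card_Diff_singleton)
  ultimately have T: "card ?T \<le> card (free_turns v e) - 1 choose (r - 1)" by simp
  have cB: "card (e ` path_turns v e) = card (path_turns v e)"
    by (rule card_image, rule inj_on_subset[OF pathD(3)[OF p]]) (auto simp: path_turns_def)
  have e0: "e 0 \<in> shared (starts z Q) (v 0)"
    using v1 ne pathD(4,5,6)[OF p N0] by (auto simp: shared_def)
  have "e ` path_turns v e \<subseteq> insert (e 0) (e ` (path_turns v e - {0}))" by blast
  then have "e ` path_turns v e \<subseteq> shared (starts z Q) (v 0)"
    using e0 path_turn_edges_shared[OF P] by blast
  moreover have "?S \<subseteq> shared (starts z Q) (v 0)"
    using v1 ne by (auto simp: shared_def free_def)
  ultimately have "card (e ` path_turns v e \<union> ?S) \<le> card (shared (starts z Q) (v 0))"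
    by (intro card_mono[OF finite_shared]) blast
  moreover have "e ` path_turns v e \<inter> ?S = {}" by (auto simp: path_turns_def free_def)
  then have "card (e ` path_turns v e \<union> ?S) = card (path_turns v e) + card ?S"
    using finite_free by (subst card_Un_disjoint) (auto simp: cB)
  ultimately show ?thesis using fd T by linarith
qed

text \<open>
  A start missing from the free rotations lowers the binomial coefficient by at least
  \<open>s - 1\<close>, and at most \<open>s\<close> path hyperedges can make up for it.
\<close>

lemma degree_le_of_free_turns_less:
  assumes P: "end_class z Q v e" and s: "card (starts z Q) = s" "r \<le> s"
    and ne: "free_turns v e \<noteq> start_idx z Q v"
  shows "degree E (v 0) \<le> Suc (s choose (r - 1))"
    and "s choose (r - 1) < degree E (v 0) \<Longrightarrow> path_turns v e = start_idx z Q v"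
proof -
  have p: "path v e" by (rule class_path[OF P])
  note sub = turns_subset_start_idx[OF P]
  have cs: "card (start_idx z Q v) = s" using starts_image(2)[OF P] s by simp
  have "card (free_turns v e) < s"
    using psubset_card_mono[of "start_idx z Q v" "free_turns v e"] sub ne cs by auto
  then have "card (free_turns v e) choose (r - 1) \<le> (s - 1) choose (r - 1)"
    by (intro binomial_right_mono) simp
  then have "free_deg e (v 0) \<le> (s - 1) choose (r - 1)" using free_deg_le[OF p] by linarith
  then have le: "degree E (v 0) + (s - 1) \<le> (s choose (r - 1)) + card (path_turns v e)"
    using binomial_step_ge[OF r3 s(2)] degree_split[OF p] by linarith
  have b: "card (path_turns v e) \<le> s" using card_mono[OF _ sub(2)] cs by simp
  show "degree E (v 0) \<le> Suc (s choose (r - 1))" using le b s r3 by linarith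
  show "path_turns v e = start_idx z Q v" if "s choose (r - 1) < degree E (v 0)"
  proof (rule card_subset_eq[OF _ sub(2)])
    show "card (path_turns v e) = card (start_idx z Q v)" using le b cs that s r3 by linarith
  qed simp
qed

text \<open>
  A start pays fully for its private hyperedges and half for those shared with other starts. If
  its degree exceeds \<open>s choose (r - 1)\<close>, then either all rotations by path hyperedges are
  possible, or \<open>v 1\<close> is a start; in both cases many of its hyperedges are shared.
\<close>

lemma start_charge:
  assumes P: "end_class z Q v e" and s: "card (starts z Q) = s" "r \<le> s"
  shows "2 * degree E (v 0) \<le> 2 * (s choose (r - 1)) + card (shared (starts z Q) (v 0))"
proof (cases "degree E (v 0) \<le> s choose (r - 1)")
  case False
  have p: "path v e" by (rule class_path[OF P])
  note sub = turns_subset_start_idx[OF P]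
  have cs: "card (start_idx z Q v) = s" using starts_image(2)[OF P] s by simp
  show ?thesis
  proof (cases "free_turns v e = start_idx z Q v")
    case nontotal: False
    have "card (path_turns v e) = s"
      using degree_le_of_free_turns_less(2)[OF P s nontotal] False cs by simp
    then show ?thesis
      using card_path_turns_le_shared[OF P] degree_le_of_free_turns_less(1)[OF P s nontotal] s r3
      by linarith
  next
    case total: True
    have cA: "card (free_turns v e) = s" using total cs by simp
    have 0: "0 \<in> free_turns v e" using zero_path_turn[OF p] sub(2) total by blast
    have fd: "Suc (free_deg e (v 0)) \<le> s choose (r - 1)"
      using first_edge_bound[OF P 0] total cA by auto
    have "1 < card (path_turns v e)" using False fd degree_split[OF p] by linarith
    then obtain i where i: "i \<in> path_turns v e" "0 < i" by (rule nonzero_path_turn)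
    then have "i \<in> free_turns v e" using sub(2) total by blast
    then have "card (path_turns v e) + free_deg e (v 0)
        \<le> card (shared (starts z Q) (v 0)) + ((s - 1) choose (r - 1))"
      using shared_ge_with_second_vertex[OF P 0 i(1)] i(2) cA by simp
    moreover have "card (path_turns v e) \<le> s" using card_mono[OF _ sub(2)] cs by simp
    ultimately show ?thesis
      using fd degree_split[OF p] binomial_step_ge[OF r3 s(2)] s r3 by linarith
  qed
qed simp

lemma card_edges_le_g:
  assumes s: "card (starts z Q) = s" "r \<le> s"
  shows "card E \<le> g r (Suc N) s"
proof -
  have subV: "starts z Q \<subseteq> V" using starts_subset by blast
  have "card {f \<in> E. f \<inter> starts z Q \<noteq> {}} \<le> card (starts z Q) * (s choose (r - 1))"
  proof (rule card_edges_meeting_by_charging[OF finite_starts finE])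
    fix x assume "x \<in> starts z Q"
    then obtain v e where "end_class z Q v e" "x = v 0" by (auto simp: starts_def)
    then show "2 * degree E x
        \<le> 2 * (s choose (r - 1)) + card {f \<in> E. x \<in> f \<and> (\<exists>y\<in>starts z Q. y \<in> f \<and> y \<noteq> x)}"
      using start_charge[OF _ s, of v e] by (simp add: shared_def)
  qed
  then show ?thesis
    using card_edges_le_meeting[OF fin sub subV] cV s by (simp add: g_def)
qed

text \<open>
  Suppose that all starts have degree above \<open>s choose (r - 1)\<close> and that the free rotations of one
  path reach all of them. Let \<open>v q\<close> be the first vertex of the path that is not a start. By its
  degree, \<open>v 0\<close> lies in some \<open>e i\<close> that leaves its free neighbourhood, and then \<open>i > q\<close>. Turning
  the path at \<open>q - 1\<close> makes \<open>v (q - 1)\<close> the first vertex. By its degree, it lies in \<open>e i\<close> or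
  shares a hyperedge that is free for the turned path with \<open>v (Suc i)\<close>. In both cases the segment
  from \<open>v q\<close> to \<open>v i\<close> can be moved to the front, so \<open>v q\<close> is a start after all.
\<close>

lemma no_total_free_turns:
  assumes P: "end_class z Q v e" and s: "card (starts z Q) = s" "r \<le> s"
    and high: "\<And>x. x \<in> starts z Q \<Longrightarrow> s choose (r - 1) < degree E x"
  shows "free_turns v e \<noteq> start_idx z Q v"
proof
  assume total: "free_turns v e = start_idx z Q v"
  have p: "path v e" "v N = z" using P unfolding end_class_def by blast+
  note sub = turns_subset_start_idx[OF P]
  let ?W = "v ` Suc ` free_turns v e"
  have cW: "card ?W = s"
    using card_free_nbrs[OF p(1)] total starts_image(2)[OF P] s by simp
  have "\<not> (\<forall>f\<in>{f \<in> E. v 0 \<in> f}. f - {v 0} \<subseteq> ?W)"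
  proof
    assume all: "\<forall>f\<in>{f \<in> E. v 0 \<in> f}. f - {v 0} \<subseteq> ?W"
    have "card {f \<in> E. v 0 \<in> f} \<le> card ?W choose (r - 1)"
      by (rule card_edges_at_le[where x = "v 0"]) (use all edgeD r3 in auto)
    then show False using high[OF start_in_starts[OF P]] cW by (simp add: degree_def)
  qed
  then obtain f y where f: "f \<in> E" "v 0 \<in> f" and y: "y \<in> f" "y \<noteq> v 0" "y \<notin> ?W" by blast
  have "f \<notin> free e" using free_edge_subset[OF p(1), of f] f y by blast
  then obtain i where i: "i < N" "f = e i" using f by (auto simp: free_def)
  have iB: "i \<in> path_turns v e" using i f by (simp add: path_turns_def)
  then have iA: "i \<in> free_turns v e" using sub(2) total by blast
  obtain l where l: "l \<le> N" "y = v l" using edgeD(1)[OF f(1)] y(1) path_index[OF p(1)] by blast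
  then obtain j where j: "l = Suc j" using y by (cases l) auto
  have jn: "v j \<notin> starts z Q"
  proof
    assume "v j \<in> starts z Q"
    then have "j \<in> free_turns v e" using l j total by (simp add: start_idx_def)
    then show False using y(3) l j by blast
  qed
  then have ji: "j < i"
    using released_edge_above[OF P iA, of j] y i l j by (metis Suc_le_lessD not_le)
  define q where "q = (LEAST q. v q \<notin> starts z Q)"
  have qn: "v q \<notin> starts z Q" unfolding q_def by (rule LeastI[of "\<lambda>q. v q \<notin> starts z Q", OF jn])
  have qj: "q \<le> j" unfolding q_def by (rule Least_le[of "\<lambda>q. v q \<notin> starts z Q", OF jn])
  have qmin: "\<And>a. a < q \<Longrightarrow> v a \<in> starts z Q"
    unfolding q_def by (blast dest: not_less_Least)
  have "q \<noteq> 0" using qn start_in_starts[OF P] by metis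
  then obtain h where h: "q = Suc h" by (cases q) auto
  have hs: "v h \<in> starts z Q" using qmin h by simp
  have hi: "h < i" "Suc h < i" using h qj ji by auto
  have hA: "h \<in> free_turns v e" using hs hi i total by (simp add: start_idx_def)
  then obtain c where c: "c \<in> free e" "v 0 \<in> c" "v (Suc h) \<in> c" by (auto simp: free_turns_def)
  let ?u = "rot_vertices h v" and ?d = "rot_edges h c e"
  have hN: "h < N" using hi i by simp
  have U: "end_class z Q ?u ?d" using rotate_free(1)[OF P hN c] .
  have di: "?d i = e i" using hi by (simp add: rot_edges_def)
  have ui: "?u i = v i" "?u (Suc i) = v (Suc i)" using hi by (auto simp: rot_vertices_def)
  have vi: "v i \<in> starts z Q" using path_turn_is_start[OF P iB] .
  then have iU: "i \<in> start_idx z Q ?u" using i ui by (simp add: start_idx_def)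
  show False
  proof (cases "free_turns ?u ?d = start_idx z Q ?u")
    case True
    then have iU': "i \<in> free_turns ?u ?d" using iU by blast
    \<comment> \<open>In the path \<open>?u\<close> the old first vertex \<open>v 0\<close> has index \<open>h\<close> and is followed by \<open>v q\<close>.\<close>
    have "?u h \<in> ?d i" using f i di by (simp add: rot_vertices_def)
    then have "?u (Suc h) \<in> starts z Q" by (rule released_edge_below[OF U iU']) (rule hi(1))
    then show False using qn h by (simp add: rot_vertices_def)
  next
    case False
    have "s choose (r - 1) < degree E (?u 0)" using high hs by (simp add: rot_vertices_def)
    then have "i \<in> path_turns ?u ?d"
      using degree_le_of_free_turns_less(2)[OF U s False] iU by blast
    then have "v h \<in> e i" using di by (simp add: path_turns_def rot_vertices_def)
    then have "v (Suc h) \<in> starts z Q" by (rule released_edge_below[OF P iA]) (rule hi(1))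
    then show False using qn h by simp
  qed
qed

text \<open>
  Otherwise, on every path of the class, the first vertex lies in each hyperedge that follows a
  start. Rotations by path hyperedges bring every start to the front and keep the hyperedge that
  follows the last start on the path. So this hyperedge contains all starts and a further vertex,
  more than \<open>r\<close> vertices in total.
\<close>

lemma exists_low_degree_start:
  assumes P0: "end_class z Q v e" and s: "card (starts z Q) = s" "r \<le> s"
  shows "\<exists>x\<in>starts z Q. degree E x \<le> s choose (r - 1)"
proof (rule ccontr)
  assume "\<not> ?thesis"
  then have high: "\<And>x. x \<in> starts z Q \<Longrightarrow> s choose (r - 1) < degree E x" by force
  have turns: "path_turns w c = start_idx z Q w" if C: "end_class z Q w c" for w c
    using degree_le_of_free_turns_less(2)[OF C s no_total_free_turns[OF C s high]]
      high[OF start_in_starts[OF C]] by blast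
  have p: "path v e" "v N = z" using P0 unfolding end_class_def by blast+
  define M where "M = Max (start_idx z Q v)"
  have ne: "start_idx z Q v \<noteq> {}" using zero_path_turn[OF p(1)] turns[OF P0] by blast
  have Mi: "M \<in> start_idx z Q v" unfolding M_def using ne by (intro Max_in) simp_all
  have Mx: "i \<le> M" if "i \<in> start_idx z Q v" for i unfolding M_def using that by (intro Max_ge) simp_all
  have MN: "M < N" using Mi by (simp add: start_idx_def)
  have in_e: "v i \<in> e M" if i: "i \<in> start_idx z Q v" for i
  proof (cases "i = M")
    case True
    then show ?thesis using pathD(5)[OF p(1) MN] by simp
  next
    case False
    then have iM: "i < M" using Mx[OF i] by simp
    let ?w = "rot_vertices i v" and ?c = "rot_edges i (e i) e"
    have C: "end_class z Q ?w ?c" using rotate_path(1)[OF P0] turns[OF P0] i by blast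
    have "M \<in> start_idx z Q ?w" using Mi iM by (simp add: start_idx_def rot_vertices_def)
    then have "M \<in> path_turns ?w ?c" using turns[OF C] by blast
    then show ?thesis using iM by (simp add: path_turns_def rot_vertices_def rot_edges_def)
  qed
  have "v (Suc M) \<notin> starts z Q"
  proof
    assume a: "v (Suc M) \<in> starts z Q"
    then have "Suc M \<noteq> N" using p(2) starts_subset by (metis Diff_iff singletonI subsetD)
    then have "Suc M \<in> start_idx z Q v" using a MN by (simp add: start_idx_def)
    then show False using Mx by fastforce
  qed
  then have "card (insert (v (Suc M)) (starts z Q)) = Suc s" using s finite_starts by simp
  moreover have "insert (v (Suc M)) (starts z Q) \<subseteq> e M"
    unfolding starts_image(1)[OF P0, symmetric] using in_e pathD(6)[OF p(1) MN] by blast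
  then have "card (insert (v (Suc M)) (starts z Q)) \<le> card (e M)"
    by (rule card_mono[OF edgeD(3)[OF pathD(4)[OF p(1) MN]]])
  then have "card (insert (v (Suc M)) (starts z Q)) \<le> r"
    using edgeD(2)[OF pathD(4)[OF p(1) MN]] by simp
  ultimately show False using s by simp
qed

lemma card_starts_ge_uniformity:
  assumes P: "end_class z Q v e" and deg: "\<And>x. x \<in> V \<Longrightarrow> r < degree E x"
  shows "r \<le> card (starts z Q)"
proof (rule ccontr)
  assume "\<not> ?thesis"
  then have lt: "card (starts z Q) \<le> r - 1" by simp
  have p: "path v e" by (rule class_path[OF P])
  note sub = turns_subset_start_idx[OF P]
  have "card (free_turns v e) \<le> r - 1" "card (path_turns v e) \<le> r - 1"
    using card_mono[OF _ sub(1)] card_mono[OF _ sub(2)] starts_image(2)[OF P] lt by simp_all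
  moreover have "card (free_turns v e) choose (r - 1) \<le> (r - 1) choose (r - 1)"
    using calculation by (intro binomial_right_mono)
  ultimately have "degree E (v 0) \<le> r"
    using degree_split[OF p] free_deg_le[OF p] r3 by (simp add: binomial_n_n)
  then show False using deg[of "v 0"] starts_subset start_in_starts[OF P] by fastforce
qed

section \<open>Only classes with many starts\<close>

lemma path_own_class:
  "path v e \<Longrightarrow> end_class (v N) {f \<in> e ` {..<N}. v N \<in> f} v e"
  by (simp add: end_class_def)

text \<open>
  A free rotation exchanges one hyperedge for another that contains \<open>v 0\<close>. Hence the hyperedges
  at any one-step rotated start that are counted neither for the path nor at \<open>v 0\<close> are free
  for the rotated path.
\<close>

lemma turned_path:
  assumes P: "end_class z Q v e" and i: "i \<in> free_turns v e \<union> path_turns v e"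
  obtains w c where "end_class z Q w c" "w 0 = v i" "{f \<in> free e. v 0 \<notin> f} \<subseteq> free c"
    "\<forall>j>i. w j = v j \<and> c j = e j"
proof (cases "i \<in> path_turns v e")
  case True
  show ?thesis
    by (rule that[of "rot_vertices i v" "rot_edges i (e i) e"])
      (use rotate_path[OF P True] in \<open>auto simp: rot_vertices_def rot_edges_def\<close>)
next
  case False
  then obtain f where f: "i < N" "f \<in> free e" "v 0 \<in> f" "v (Suc i) \<in> f"
    using i by (auto simp: free_turns_def)
  have "{f \<in> free e. v 0 \<notin> f} \<subseteq> free (rot_edges i f e)"
    using f(3) rot_edges_image[OF f(1), of f e] by (auto simp: free_def)
  then show ?thesis
    by (intro that[of "rot_vertices i v" "rot_edges i f e"])
      (use rotate_free[OF P f] in \<open>auto simp: rot_vertices_def rot_edges_def\<close>)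
qed

text \<open>
  The starts reached from one path share its \<open>N\<close> hyperedges. So these are counted once and not
  once per start, which is the gain over adding up degrees.
\<close>

lemma card_edges_meeting_turns:
  assumes p: "path v e" and I: "I \<subseteq> free_turns v e \<union> path_turns v e" "0 \<in> I"
    and D: "\<And>w c. path w c \<Longrightarrow> card (free_turns w c) \<le> D"
  shows "card {f \<in> E. f \<inter> v ` I \<noteq> {}}
    \<le> card {j. j < N \<and> e j \<inter> v ` I \<noteq> {}} + free_deg e (v 0) + (card I - 1) * (D choose (r - 1))"
proof -
  let ?J = "{j. j < N \<and> e j \<inter> v ` I \<noteq> {}}" and ?X = "\<lambda>i. {f \<in> free e. v i \<in> f \<and> v 0 \<notin> f}"
  have fI: "finite I" using I(1) by (rule finite_subset) simp
  have X: "card (?X i) \<le> D choose (r - 1)" if i: "i \<in> I - {0}" for i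
  proof -
    have "i \<in> free_turns v e \<union> path_turns v e" using i I(1) by blast
    then obtain w c where C: "end_class (v N) {f \<in> e ` {..<N}. v N \<in> f} w c" "w 0 = v i"
        "{f \<in> free e. v 0 \<notin> f} \<subseteq> free c"
      by (rule turned_path[OF path_own_class[OF p]])
    have pw: "path w c" by (rule class_path[OF C(1)])
    have "?X i \<subseteq> {f \<in> free c. w 0 \<in> f}" using C(2,3) by auto
    then have "card (?X i) \<le> free_deg c (w 0)"
      unfolding free_deg_def using finite_free by (intro card_mono) auto
    also have "\<dots> \<le> D choose (r - 1)"
      using free_deg_le[OF pw] binomial_right_mono[OF D[OF pw]] by (rule order_trans)
    finally show ?thesis .
  qed
  have "{f \<in> E. f \<inter> v ` I \<noteq> {}} \<subseteq> (e ` ?J \<union> {f \<in> free e. v 0 \<in> f}) \<union> (\<Union>i\<in>I - {0}. ?X i)"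
  proof
    fix f assume f: "f \<in> {f \<in> E. f \<inter> v ` I \<noteq> {}}"
    then obtain i where i: "i \<in> I" "v i \<in> f" by blast
    show "f \<in> (e ` ?J \<union> {f \<in> free e. v 0 \<in> f}) \<union> (\<Union>i\<in>I - {0}. ?X i)"
    proof (cases "f \<in> free e")
      case True
      then show ?thesis using i by (cases "v 0 \<in> f") auto
    next
      case False
      then obtain j where "j < N" "f = e j" using f by (auto simp: free_def)
      then show ?thesis using f by blast
    qed
  qed
  then have "card {f \<in> E. f \<inter> v ` I \<noteq> {}}
      \<le> card ((e ` ?J \<union> {f \<in> free e. v 0 \<in> f}) \<union> (\<Union>i\<in>I - {0}. ?X i))"
    by (rule card_mono[rotated]) (use finite_free fI in auto)
  also have "\<dots> \<le> card (e ` ?J \<union> {f \<in> free e. v 0 \<in> f}) + card (\<Union>i\<in>I - {0}. ?X i)"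
    by (rule card_Un_le)
  also have "\<dots> \<le> card (e ` ?J) + free_deg e (v 0) + card (\<Union>i\<in>I - {0}. ?X i)"
    unfolding free_deg_def by (intro add_right_mono card_Un_le)
  also have "\<dots> \<le> card ?J + free_deg e (v 0) + card (\<Union>i\<in>I - {0}. ?X i)"
    by (intro add_right_mono card_image_le) simp
  also have "card (\<Union>i\<in>I - {0}. ?X i) \<le> (\<Sum>i\<in>I - {0}. card (?X i))"
    using fI by (intro card_UN_le) simp
  also have "\<dots> \<le> (\<Sum>i\<in>I - {0}. D choose (r - 1))" by (rule sum_mono) (rule X)
  also have "\<dots> = (card I - 1) * (D choose (r - 1))" using I(2) fI by (simp add: card_Diff_singleton)
  finally show ?thesis by simp
qed

lemma card_turned_vertices:
  assumes p: "path v e" and I: "I \<subseteq> free_turns v e \<union> path_turns v e"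
  shows "card (v ` I) = card I" "v ` I \<subseteq> V"
proof -
  have IN: "I \<subseteq> {..N}" using I by (auto simp: free_turns_def path_turns_def)
  show "card (v ` I) = card I" by (rule card_image, rule inj_on_subset[OF pathD(1)[OF p] IN])
  show "v ` I \<subseteq> V" using image_mono[OF IN, of v] pathD(2)[OF p] by simp
qed

text \<open>
  Either one path turns to \<open>m\<close> starts, which share its hyperedges, or all degrees of starts are
  small.
\<close>

lemma card_edges_le_of_few_free_turns:
  assumes m: "r < m" "N \<le> 2 * m + 1" "2 * m \<le> N"
    and D: "\<And>w c. path w c \<Longrightarrow> card (free_turns w c) \<le> m - 1"
    and P: "end_class z Q v e" and many: "m \<le> card (starts z Q)"
  shows "card E \<le> g r (Suc N) m"
proof -
  have step: "((m - 1) choose (r - 1)) + (m - 1) \<le> m choose (r - 1)"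
    using binomial_step_ge[OF r3, of m] m by simp
  have "\<exists>K\<subseteq>V. card K = m \<and> card {f \<in> E. f \<inter> K \<noteq> {}} \<le> m * (m choose (r - 1))"
  proof (cases "\<exists>w c. path w c \<and> m \<le> card (free_turns w c \<union> path_turns w c)")
    case True
    then obtain w c where w: "path w c" "m \<le> card (free_turns w c \<union> path_turns w c)" by blast
    let ?T = "free_turns w c \<union> path_turns w c"
    have "0 \<in> ?T" using zero_path_turn[OF w(1)] by blast
    then have "m - 1 \<le> card (?T - {0})" using w(2) by (simp add: card_Diff_singleton)
    then obtain I' where I': "I' \<subseteq> ?T - {0}" "card I' = m - 1"
      using obtain_subset_with_card_n by metis
    let ?I = "insert 0 I'"
    have fI': "finite I'" using I'(1) by (rule finite_subset) simp
    have I: "?I \<subseteq> ?T" "card ?I = m" using I' fI' \<open>0 \<in> ?T\<close> m r3 by (auto simp: card_insert_if)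
    have "card {j. j < N \<and> c j \<inter> w ` ?I \<noteq> {}} \<le> card {..<N}" by (rule card_mono) auto
    moreover have "free_deg c (w 0) \<le> (m - 1) choose (r - 1)"
      using free_deg_le[OF w(1)] binomial_right_mono[OF D[OF w(1)]] by (rule order_trans)
    ultimately have "card {f \<in> E. f \<inter> w ` ?I \<noteq> {}}
        \<le> N + ((m - 1) choose (r - 1)) + (m - 1) * ((m - 1) choose (r - 1))"
      using card_edges_meeting_turns[OF w(1) I(1) _ D] I(2) by simp
    also have "\<dots> = N + m * ((m - 1) choose (r - 1))" using m by (cases m) simp_all
    also have "\<dots> \<le> m * (((m - 1) choose (r - 1)) + (m - 1))"
    proof -
      have "m * 3 \<le> m * (m - 1)" using m r3 by (intro mult_le_mono2) linarith
      then have "N \<le> m * (m - 1)" using m r3 by linarith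
      then show ?thesis unfolding add_mult_distrib2 by linarith
    qed
    also have "\<dots> \<le> m * (m choose (r - 1))" using step by (rule mult_le_mono2)
    finally show ?thesis using card_turned_vertices[OF w(1) I(1)] I(2) by metis
  next
    case False
    obtain K where K: "K \<subseteq> starts z Q" "card K = m"
      using obtain_subset_with_card_n[OF many] by metis
    have KV: "K \<subseteq> V" using K(1) starts_subset by blast
    have "card {f \<in> E. f \<inter> K \<noteq> {}} \<le> card K * (m choose (r - 1))"
    proof (rule card_edges_meeting_by_charging[OF finite_subset[OF KV fin] finE])
      fix x assume "x \<in> K"
      then obtain w c where w: "end_class z Q w c" "x = w 0" using K(1) by (auto simp: starts_def)
      have p: "path w c" by (rule class_path[OF w(1)])
      have "card (path_turns w c) \<le> card (free_turns w c \<union> path_turns w c)" by (rule card_mono) auto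
      then have "card (path_turns w c) \<le> m - 1" using False p by fastforce
      moreover have "free_deg c (w 0) \<le> (m - 1) choose (r - 1)"
        using free_deg_le[OF p] binomial_right_mono[OF D[OF p]] by (rule order_trans)
      ultimately have "degree E x \<le> m choose (r - 1)"
        unfolding w(2) using degree_split[OF p] step by linarith
      then show "2 * degree E x \<le> 2 * (m choose (r - 1)) + card {f \<in> E. x \<in> f \<and> (\<exists>y\<in>K. y \<in> f \<and> y \<noteq> x)}"
        by simp
    qed
    then show ?thesis using K(2) KV by metis
  qed
  then obtain K where "K \<subseteq> V" "card K = m" "card {f \<in> E. f \<inter> K \<noteq> {}} \<le> m * (m choose (r - 1))" by blast
  then show ?thesis using card_edges_le_meeting[OF fin sub, of K] cV by (simp add: g_def)
qed

text \<open>
  The rotation to the start \<open>x\<close> does not touch the last hyperedge of the path, so this hyperedge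
  contains the new first vertex and allows a further rotation.
\<close>

lemma last_path_edge_meets_turns:
  assumes P: "end_class z Q v e" and I: "starts z Q \<subseteq> v ` (free_turns v e \<union> path_turns v e)"
    and x: "x \<in> e (N - 1)" "x \<in> starts z Q"
  shows "v (N - 1) \<in> starts z Q"
proof -
  obtain i where i: "i \<in> free_turns v e \<union> path_turns v e" "x = v i" using I x by blast
  have iN: "i < N" using i by (auto simp: free_turns_def path_turns_def)
  show ?thesis
  proof (cases "i = N - 1")
    case True
    then show ?thesis using x i by simp
  next
    case False
    obtain w c where w: "end_class z Q w c" "w 0 = v i" "{f \<in> free e. v 0 \<notin> f} \<subseteq> free c"
        "\<forall>j>i. w j = v j \<and> c j = e j"
      by (rule turned_path[OF P i(1)])
    have "w (N - 1) = v (N - 1)" "c (N - 1) = e (N - 1)" using w(4) False iN by auto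
    then have "N - 1 \<in> path_turns w c" using w(2) x i iN by (simp add: path_turns_def)
    then show ?thesis using path_turn_is_start[OF w(1)] \<open>w (N - 1) = v (N - 1)\<close> by metis
  qed
qed

text \<open>
  The path has \<open>2 * m + 1\<close> hyperedges, one more than the bound allows. One is saved: unless
  \<open>v (N - 1)\<close> is a start, the last hyperedge avoids all starts; if it is one, then \<open>v 0\<close> has fewer
  than \<open>m choose (r - 1)\<close> free hyperedges.
\<close>

lemma edges_meeting_starts_of_full_turning_path:
  assumes m: "r < m" "N = 2 * m + 1" and D: "\<And>w c. path w c \<Longrightarrow> card (free_turns w c) \<le> m"
    and P: "end_class z Q v e" and s: "card (starts z Q) = Suc m"
    and full: "free_turns v e \<union> path_turns v e = start_idx z Q v"
  shows "card {f \<in> E. f \<inter> starts z Q \<noteq> {}} \<le> Suc m * (m choose (r - 1)) + 2 * m"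
proof -
  have p: "path v e" "v N = z" using P unfolding end_class_def by blast+
  have im: "v ` start_idx z Q v = starts z Q" and cs: "card (start_idx z Q v) = Suc m"
    using starts_image[OF P] s by simp_all
  let ?J = "{j. j < N \<and> e j \<inter> starts z Q \<noteq> {}}"
  have 0: "0 \<in> start_idx z Q v" using zero_path_turn[OF p(1)] full by blast
  have main: "card {f \<in> E. f \<inter> starts z Q \<noteq> {}} \<le> card ?J + free_deg e (v 0) + m * (m choose (r - 1))"
    using card_edges_meeting_turns[OF p(1) equalityD2[OF full] 0 D] unfolding im cs by simp
  have fd: "free_deg e (v 0) \<le> m choose (r - 1)"
    using free_deg_le[OF p(1)] binomial_right_mono[OF D[OF p(1)]] by (rule order_trans)
  have "card ?J + free_deg e (v 0) \<le> (m choose (r - 1)) + 2 * m"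
  proof (cases "v (N - 1) \<in> starts z Q")
    case False
    have "e (N - 1) \<inter> starts z Q = {}"
      using last_path_edge_meets_turns[OF P] False im full by blast
    then have "?J \<subseteq> {..<2 * m}"
    proof -
      assume a: "e (N - 1) \<inter> starts z Q = {}"
      show ?thesis
      proof
        fix j assume j: "j \<in> ?J"
        then have "j \<noteq> 2 * m" using a m by auto
        then show "j \<in> {..<2 * m}" using j m by simp
      qed
    qed
    then have "card ?J \<le> 2 * m" using card_mono[of "{..<2 * m}" ?J] by simp
    then show ?thesis using fd by simp
  next
    case True
    have "card ?J \<le> card {..<N}" by (rule card_mono) auto
    then have J: "card ?J \<le> 2 * m + 1" using m by simp
    have "Suc (free_deg e (v 0)) \<le> m choose (r - 1)"
    proof (cases "card (free_turns v e) = m")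
      case a: True
      have "N - 1 \<in> start_idx z Q v" using True r3 rN by (simp add: start_idx_def)
      moreover have nA: "N - 1 \<notin> free_turns v e"
        using rotate_free(4)[OF P, of "N - 1"] by (auto simp: free_turns_def)
      moreover have "card (insert (N - 1) (free_turns v e)) = Suc m" using a nA by simp
      ultimately have eq: "insert (N - 1) (free_turns v e) = start_idx z Q v"
        using turns_subset_start_idx(1)[OF P] cs by (intro card_subset_eq) auto
      have "0 \<noteq> N - 1" using m by simp
      then have "0 \<in> free_turns v e" using 0 eq by blast
      then show ?thesis using first_edge_bound[OF P _ equalityD2[OF eq]] a by simp
    next
      case False
      then have "card (free_turns v e) \<le> m - 1" using D[OF p(1)] by linarith
      then have "card (free_turns v e) choose (r - 1) \<le> (m - 1) choose (r - 1)"
        by (rule binomial_right_mono)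
      then show ?thesis using free_deg_le[OF p(1)] binomial_step_ge[OF r3, of m] m r3 by linarith
    qed
    then show ?thesis using J by linarith
  qed
  then show ?thesis using main by simp
qed

text \<open>
  The excess over \<open>m choose (r - 1)\<close> may now be \<open>1\<close>. As the rotations miss a start, a path with
  \<open>m\<close> free rotations has no others, so \<open>0\<close> and all path rotations are free rotations as well.
\<close>

lemma start_charge_without_full_turning:
  assumes m: "r < m" and D: "\<And>w c. path w c \<Longrightarrow> card (free_turns w c) \<le> m"
    and P: "end_class z Q v e" and s: "card (starts z Q) = Suc m"
    and nfull: "free_turns v e \<union> path_turns v e \<noteq> start_idx z Q v"
  shows "2 * degree E (v 0) \<le> 2 * Suc (m choose (r - 1)) + card (shared (starts z Q) (v 0))"
proof -
  have p: "path v e" by (rule class_path[OF P])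
  note subs = turns_subset_start_idx[OF P]
  have cs: "card (start_idx z Q v) = Suc m" using starts_image(2)[OF P] s by simp
  have step: "((m - 1) choose (r - 1)) + (m - 1) \<le> m choose (r - 1)"
    using binomial_step_ge[OF r3, of m] m by simp
  have "free_turns v e \<union> path_turns v e \<subset> start_idx z Q v" using subs nfull by blast
  then have ab: "card (free_turns v e \<union> path_turns v e) \<le> m"
    using psubset_card_mono[of "start_idx z Q v" "free_turns v e \<union> path_turns v e"] cs by simp
  have "card (path_turns v e) \<le> card (free_turns v e \<union> path_turns v e)" by (rule card_mono) auto
  then have b: "card (path_turns v e) \<le> m" using ab by simp
  show ?thesis
  proof (cases "card (free_turns v e) = m")
    case False
    then have "card (free_turns v e) \<le> m - 1" using D[OF p] by linarith
    then have "card (free_turns v e) choose (r - 1) \<le> (m - 1) choose (r - 1)"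
      by (rule binomial_right_mono)
    then have "degree E (v 0) \<le> Suc (m choose (r - 1))"
      using free_deg_le[OF p] degree_split[OF p] step b m by linarith
    then show ?thesis by simp
  next
    case a: True
    have "free_turns v e = free_turns v e \<union> path_turns v e"
      by (rule card_seteq) (use ab a in auto)
    then have BA: "path_turns v e \<subseteq> free_turns v e" by blast
    have fd: "free_deg e (v 0) \<le> m choose (r - 1)" using free_deg_le[OF p] a by simp
    show ?thesis
    proof (cases "1 < card (path_turns v e)")
      case False
      then show ?thesis using degree_split[OF p] fd by simp
    next
      case True
      then obtain i where i: "i \<in> path_turns v e" "0 < i" by (rule nonzero_path_turn)
      have "card (path_turns v e) + free_deg e (v 0)
          \<le> card (shared (starts z Q) (v 0)) + ((m - 1) choose (r - 1))"
        using shared_ge_with_second_vertex[OF P _ i(1) _ i(2)] BA zero_path_turn[OF p] i a by auto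
      then have "2 * degree E (v 0) \<le> 2 * (m choose (r - 1)) + 2 + card (shared (starts z Q) (v 0))"
        using fd degree_split[OF p] step b by linarith
      then show ?thesis by simp
    qed
  qed
qed

text \<open>
  Passing from \<open>m\<close> to \<open>m + 1\<close> vertices removes \<open>(m choose (r - 1)) + (m choose (r - 2))\<close> sets
  from the complement. The first summand pays for the additional start, the second, which is at
  least \<open>m\<close>, for half of the excess \<open>2 * m\<close> of the count at the starts.
\<close>

lemma card_edges_le_of_smallest_class:
  assumes m: "r < m" "N = 2 * m + 1" and D: "\<And>w c. path w c \<Longrightarrow> card (free_turns w c) \<le> m"
    and s: "card (starts z Q) = Suc m"
  shows "card E \<le> g r (Suc N) m + m"
proof -
  have M: "card {f \<in> E. f \<inter> starts z Q \<noteq> {}} \<le> Suc m * (m choose (r - 1)) + 2 * m"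
  proof (cases "\<exists>v e. end_class z Q v e \<and> free_turns v e \<union> path_turns v e = start_idx z Q v")
    case True
    then show ?thesis using edges_meeting_starts_of_full_turning_path[OF m D _ s] by blast
  next
    case False
    have "card {f \<in> E. f \<inter> starts z Q \<noteq> {}} \<le> card (starts z Q) * Suc (m choose (r - 1))"
    proof (rule card_edges_meeting_by_charging[OF finite_starts finE])
      fix x assume "x \<in> starts z Q"
      then obtain v e where "end_class z Q v e" "x = v 0" by (auto simp: starts_def)
      then show "2 * degree E x
          \<le> 2 * Suc (m choose (r - 1)) + card {f \<in> E. x \<in> f \<and> (\<exists>y\<in>starts z Q. y \<in> f \<and> y \<noteq> x)}"
        using start_charge_without_full_turning[OF m(1) D _ s, of v e] False by (simp add: shared_def)
    qed
    also have "\<dots> = Suc m * (m choose (r - 1)) + Suc m" unfolding s by simp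
    finally show ?thesis using m by simp
  qed
  have subV: "starts z Q \<subseteq> V" using starts_subset by blast
  have "Suc N - Suc m = Suc m" "Suc N - m = Suc (Suc m)" using m by auto
  then have E: "card E \<le> (Suc m choose r) + card {f \<in> E. f \<inter> starts z Q \<noteq> {}}"
    and g: "g r (Suc N) m = (Suc (Suc m) choose r) + m * (m choose (r - 1))"
    using card_edges_le_meeting[OF fin sub subV] cV s by (simp_all add: g_def)
  obtain q where q: "r = Suc (Suc q)" using r3 by (metis add_2_eq_Suc le_Suc_ex numeral_3_eq_3 Suc_leD add.commute numeral_2_eq_2)
  have "m \<le> m choose q" by (rule binomial_ge_top) (use q r3 m in auto)
  then have "(Suc m choose r) + (m choose (r - 1)) + m \<le> Suc (Suc m) choose r" by (simp add: q)
  then show ?thesis using E M g by simp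
qed

end

section \<open>The bound on the number of hyperedges\<close>

lemma degree_ge_of_min_degree:
  assumes "finite V" "k \<le> min_degree V E" "x \<in> V"
  shows "k \<le> degree E x"
proof -
  have "Min (degree E ` V) \<le> degree E x" using assms by (intro Min_le) auto
  then show ?thesis using assms(2) by (simp add: min_degree_def)
qed

lemma degree_mono:
  assumes "finite E'" "E \<subseteq> E'"
  shows "degree E x \<le> degree E' x"
  unfolding degree_def by (rule card_mono) (use assms in auto)

lemma half_gt_uniformity:
  fixes r k m :: nat
  assumes "3 \<le> r" "r + 1 \<le> k" "k < m choose (r - 1)"
  shows "r < m"
proof (rule ccontr)
  assume "\<not> r < m"
  then have "m choose (r - 1) \<le> r choose (r - 1)" by (intro binomial_right_mono) simp
  also have "\<dots> = r" using assms(1) by (cases r) auto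
  finally show False using assms by simp
qed

lemma parameter_le:
  fixes a b k r t s :: nat
  assumes "(t - 1) choose (r - 1) < k" "k \<le> s choose (r - 1)"
  shows "t \<le> s"
proof (rule ccontr)
  assume "\<not> t \<le> s"
  then have "s choose (r - 1) \<le> (t - 1) choose (r - 1)" by (intro binomial_right_mono) simp
  then show False using assms by simp
qed

lemma (in nonhamiltonian) card_edges_le_max:
  assumes P: "path v0 e0" and m: "m = N div 2"
    and k: "r + 1 \<le> k" "k < m choose (r - 1)"
    and t: "(t - 1) choose (r - 1) < k" and deg: "\<And>x. x \<in> V \<Longrightarrow> k \<le> degree E x"
  shows "card E \<le> max (g r (Suc N) t) (g r (Suc N) m + (if even N then 0 else m))"
proof (cases "\<exists>v e z Q. end_class z Q v e \<and> card (starts z Q) \<le> m")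
  case True
  then obtain v e z Q where P: "end_class z Q v e" and le: "card (starts z Q) \<le> m" by blast
  have "r < degree E x" if "x \<in> V" for x using deg[OF that] k by simp
  then have s: "r \<le> card (starts z Q)" by (rule card_starts_ge_uniformity[OF P])
  obtain x where "x \<in> starts z Q" "degree E x \<le> card (starts z Q) choose (r - 1)"
    using exists_low_degree_start[OF P refl s] by blast
  then have "k \<le> card (starts z Q) choose (r - 1)" using deg starts_subset by fastforce
  then have "t \<le> card (starts z Q)" by (rule parameter_le[OF t])
  moreover have "m \<le> Suc N" using m by simp
  ultimately have "g r (Suc N) (card (starts z Q)) \<le> max (g r (Suc N) t) (g r (Suc N) m)"
    using le r3 by (intro g_le_max_endpoints) auto
  then show ?thesis using card_edges_le_g[OF refl s] by simp
next
  case False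
  then have many: "m < card (starts z Q)" if "end_class z Q v e" for v e z Q
    using that by (meson not_le)
  have rm: "r < m" by (rule half_gt_uniformity[OF r3 k])
  have mN: "2 * m \<le> N" "N \<le> 2 * m + 1" using m by auto
  have a: "card (free_turns w c) + card (starts (w 0) {f \<in> c ` {..<N}. w 0 \<in> f}) \<le> N"
    and b: "m < card (starts (w 0) {f \<in> c ` {..<N}. w 0 \<in> f})" if "path w c" for w c
    using starts_from_end_le[OF that] many[OF path_reverse_class[OF that]] by auto
  have P0: "end_class (v0 N) {f \<in> e0 ` {..<N}. v0 N \<in> f} v0 e0" by (rule path_own_class[OF P])
  show ?thesis
  proof (cases "\<forall>w c. path w c \<longrightarrow> card (free_turns w c) \<le> m - 1")
    case True
    then have "card E \<le> g r (Suc N) m"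
      using card_edges_le_of_few_free_turns[OF rm mN(2,1) _ P0] many[OF P0] by simp
    then show ?thesis by simp
  next
    case False
    then obtain w c where w: "path w c" "m \<le> card (free_turns w c)" by fastforce
    have "N = 2 * m + 1" "card (starts (w 0) {f \<in> c ` {..<N}. w 0 \<in> f}) = Suc m"
      using a[OF w(1)] b[OF w(1)] w(2) mN by linarith+
    moreover have "card (free_turns u d) \<le> m" if "path u d" for u d
      using a[OF that] b[OF that] mN by linarith
    ultimately have "card E \<le> g r (Suc N) m + m" "odd N"
      using card_edges_le_of_smallest_class[OF rm] by auto
    then show ?thesis by simp
  qed
qed

lemma card_edges_bound:
  fixes V :: "'a set"
  assumes r: "3 \<le> r" and n: "n > 2 * r"
    and k: "r + 1 \<le> k" "k < ((n - 1) div 2) choose (r - 1)"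
    and t: "((t - 1) choose (r - 1)) < k"
    and H: "uniform_hypergraph r V E" "card V = n" "\<not> has_berge_hamiltonian_cycle V E"
      "k \<le> min_degree V E"
  shows "card E \<le> (if odd n
                   then max (g r n t) (g r n ((n - 1) div 2))
                   else max (g r n t) (g r n ((n - 2) div 2) + (n div 2 - 1)))"
proof -
  obtain N where N: "n = Suc N" using n by (cases n) auto
  have fin: "finite V" and sub: "E \<subseteq> nsets V r" using H by (auto simp: uniform_hypergraph_def)
  obtain E' v e where E': "E \<subseteq> E'" "E' \<subseteq> nsets V r" "\<not> has_berge_hamiltonian_cycle V E'"
      "ham_path V E' N v e"
    by (rule nonhamiltonian_extension_with_ham_path[of V N r E]) (use fin H sub N n r in auto)
  interpret nonhamiltonian V E' N r
    by unfold_locales (use fin H N n r E' in auto)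
  have "k \<le> degree E' x" if "x \<in> V" for x
    using degree_ge_of_min_degree[OF fin H(4) that] degree_mono[OF finE E'(1)] by (rule order_trans)
  then have "card E' \<le> max (g r (Suc N) t) (g r (Suc N) (N div 2) + (if even N then 0 else N div 2))"
    using card_edges_le_max[OF E'(4) refl k(1) _ t] k(2) N by simp
  moreover have "card E \<le> card E'" using E'(1) finE by (rule card_mono[rotated])
  moreover have "(N - 1) div 2 = N div 2" if "odd N" using that by (auto elim!: oddE)
  moreover have "Suc N div 2 - 1 = N div 2" if "odd N" using that by (auto elim!: oddE)
  ultimately show ?thesis by (cases "even N") (simp_all add: N)
qed

section \<open>The extremal hypergraphs\<close>

lemma is_H1_exists:
  assumes "2 * s \<le> n"
  shows "\<exists>(V :: nat set) E. is_H1 r n s V E"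
proof -
  have "is_H1 r n s ({0..<s} \<union> {s..<n})
     (nsets {s..<n} r \<union> {{x} \<union> R | x R. x \<in> {0..<s} \<and> R \<in> nsets {s..<s + s} (r - 1)})"
    unfolding is_H1_def
    by (rule exI[of _ "{0..<s}"], rule exI[of _ "{s..<s + s}"], rule exI[of _ "{s..<n}"],
      intro conjI refl) (use assms in auto)
  then show ?thesis by blast
qed

text \<open>
  On a Hamiltonian Berge cycle both neighbours of a vertex of \<open>T\<close> lie in \<open>S\<close>. As \<open>T\<close> and \<open>S\<close>
  have equal size, successor and predecessor map \<open>T\<close> onto \<open>S\<close>, so the cycle never leaves
  \<open>T \<union> S\<close>.
\<close>

lemma is_H1_not_hamiltonian:
  assumes H: "is_H1 r n s V E" and s: "0 < s" "2 * s < n"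
  shows "\<not> has_berge_hamiltonian_cycle V E"
proof
  obtain T S A where fT: "finite T" "finite A" and c: "card T = s" "card S = s" "card A = n - s"
    and d: "T \<inter> A = {}" "S \<subseteq> A" and V: "V = T \<union> A"
    and E: "E = nsets A r \<union> {{x} \<union> R | x R. x \<in> T \<and> R \<in> nsets S (r - 1)}"
    using H unfolding is_H1_def by (elim exE conjE) (rule that)
  have fS: "finite S" using d fT finite_subset by blast
  have cV: "card V = n" using V fT d(1) c s by (simp add: card_Un_disjoint)
  have nbr: "y \<in> S" if "f \<in> E" "x \<in> f" "x \<in> T" "y \<in> f" "y \<noteq> x" for f x y
    using that E d by (auto simp: nsets_def)
  assume "has_berge_hamiltonian_cycle V E"
  then obtain vs es where cyc: "berge_cycle E vs es" and sv: "set vs = V"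
    unfolding has_berge_hamiltonian_cycle_def by blast
  have dv: "distinct vs" and se: "set es \<subseteq> E" and le: "length es = length vs"
    and inc: "\<And>i. i < length vs \<Longrightarrow> vs ! i \<in> es ! i \<and> vs ! ((i + 1) mod length vs) \<in> es ! i"
    using cyc by (auto simp: berge_cycle_def)
  have len: "length vs = n" using distinct_card[OF dv] sv cV by simp
  define nx where "nx = (\<lambda>i. (i + 1) mod n)"
  have n2: "2 \<le> n" using s by simp
  have nxn: "nx i < n" for i using n2 by (simp add: nx_def)
  have nxne: "nx i \<noteq> i" if "i < n" for i
    using that n2 by (cases "i + 1 = n") (auto simp: nx_def)
  have inj_nx: "inj_on nx {..<n}"
    by (rule inj_onI) (metis add.commute add_mod_inj lessThan_iff nx_def)
  have adj: "vs ! nx i \<noteq> vs ! i \<and> (\<exists>f\<in>E. vs ! i \<in> f \<and> vs ! nx i \<in> f)" if "i < n" for i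
    using that inc[of i] nxne[of i] nxn[of i] dv len se le
    by (auto simp: nx_def nth_eq_iff_index_eq subset_iff)
  let ?I = "\<lambda>X. {i. i < n \<and> vs ! i \<in> X}"
  have cI: "card (?I X) = card X" if "X \<subseteq> V" for X
  proof -
    have "bij_betw (\<lambda>i. vs ! i) (?I X) X"
      unfolding bij_betw_def
    proof
      show "inj_on (\<lambda>i. vs ! i) (?I X)" using dv len by (auto simp: inj_on_def nth_eq_iff_index_eq)
      show "(\<lambda>i. vs ! i) ` ?I X = X"
      proof
        show "X \<subseteq> (\<lambda>i. vs ! i) ` ?I X"
        proof
          fix x assume x: "x \<in> X"
          then have "x \<in> set vs" using that sv by blast
          then obtain i where "i < n" "vs ! i = x" using len by (metis in_set_conv_nth)
          then show "x \<in> (\<lambda>i. vs ! i) ` ?I X" using x by blast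
        qed
      qed auto
    qed
    then show ?thesis by (rule bij_betw_same_card)
  qed
  have cards: "card (?I T) = s" "card (?I S) = s" using cI[of T] cI[of S] c V d by auto
  have TS: "nx ` ?I T \<subseteq> ?I S"
  proof
    fix j assume "j \<in> nx ` ?I T"
    then obtain i where i: "i < n" "vs ! i \<in> T" "j = nx i" by blast
    then show "j \<in> ?I S" using adj[OF i(1)] nbr nxn by blast
  qed
  have ST: "{i. i < n \<and> nx i \<in> ?I T} \<subseteq> ?I S"
  proof
    fix i assume i: "i \<in> {i. i < n \<and> nx i \<in> ?I T}"
    then have "i < n" "vs ! nx i \<in> T" by auto
    then show "i \<in> ?I S" using adj[of i] nbr by (metis (mono_tags, lifting) mem_Collect_eq)
  qed
  have "nx ` {..<n} = {..<n}"
    by (rule endo_inj_surj[OF _ _ inj_nx]) (use nxn in auto)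
  have "nx ` {i. i < n \<and> nx i \<in> ?I T} = ?I T"
  proof
    show "?I T \<subseteq> nx ` {i. i < n \<and> nx i \<in> ?I T}"
    proof
      fix j assume j: "j \<in> ?I T"
      then have "j \<in> nx ` {..<n}" using \<open>nx ` {..<n} = {..<n}\<close> by simp
      then obtain i where "i < n" "j = nx i" by blast
      then show "j \<in> nx ` {i. i < n \<and> nx i \<in> ?I T}" using j by blast
    qed
  qed blast
  moreover have "card (nx ` {i. i < n \<and> nx i \<in> ?I T}) = card {i. i < n \<and> nx i \<in> ?I T}"
    by (rule card_image, rule inj_on_subset[OF inj_nx]) auto
  ultimately have "{i. i < n \<and> nx i \<in> ?I T} = ?I S"
    using cards ST by (intro card_subset_eq) auto
  then have closed: "vs ! nx i \<in> T \<union> S" if "i < n" "vs ! i \<in> T \<union> S" for i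
    using that TS by blast
  have "?I T \<noteq> {}" using cards(1) s by (metis card.empty less_numeral_extra(3))
  then obtain i0 where i0: "i0 < n" "vs ! i0 \<in> T" by blast
  have "vs ! ((i0 + j) mod n) \<in> T \<union> S" for j
  proof (induction j)
    case (Suc j)
    have "nx ((i0 + j) mod n) = (i0 + Suc j) mod n" by (simp add: nx_def mod_Suc_eq)
    then show ?case using closed[OF _ Suc.IH] n2 by simp
  qed (use i0 in simp)
  then have all: "vs ! ((i0 + j) mod n) \<in> T \<union> S" for j by blast
  have "V \<subseteq> T \<union> S"
  proof
    fix x assume "x \<in> V"
    then obtain i where i: "i < n" "vs ! i = x" using sv len by (metis in_set_conv_nth)
    have "(i0 + (i + n - i0)) mod n = i" using i i0 by simp
    then show "x \<in> T \<union> S" using all[of "i + n - i0"] i by simp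
  qed
  then have "n \<le> card (T \<union> S)" using cV card_mono[of "T \<union> S" V] fT fS by simp
  then show False using card_Un_le[of T S] c s by linarith
qed

lemma is_H1_properties:
  assumes H: "is_H1 r n s V E" and r: "2 \<le> r" and s: "2 * s \<le> n" "0 < n"
    and k: "k \<le> s choose (r - 1)" "k \<le> (n - s - 1) choose (r - 1)"
  shows "uniform_hypergraph r V E" "card V = n" "k \<le> min_degree V E" "card E = g r n s"
proof -
  obtain T S A where fT: "finite T" "finite A" and c: "card T = s" "card S = s" "card A = n - s"
    and d: "T \<inter> A = {}" "S \<subseteq> A" and V: "V = T \<union> A"
    and E: "E = nsets A r \<union> {{x} \<union> R | x R. x \<in> T \<and> R \<in> nsets S (r - 1)}"
    using H unfolding is_H1_def by (elim exE conjE) (rule that)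
  have fS: "finite S" using d fT finite_subset by blast
  let ?F = "{{x} \<union> R | x R. x \<in> T \<and> R \<in> nsets S (r - 1)}"
  have F: "?F = (\<lambda>(x, R). insert x R) ` (T \<times> nsets S (r - 1))" by auto
  have TS: "T \<inter> S = {}" using d by blast
  have inj: "inj_on (\<lambda>(x, R). insert x R) (T \<times> nsets S (r - 1))"
  proof (rule inj_onI, clarify)
    fix x R y R' assume a: "x \<in> T" "R \<in> nsets S (r - 1)" "y \<in> T" "R' \<in> nsets S (r - 1)"
      "insert x R = insert y R'"
    then have "R \<subseteq> S" "R' \<subseteq> S" by (auto simp: nsets_def)
    then have nin: "x \<notin> R" "x \<notin> R'" "y \<notin> R'" using a(1,3) TS by blast+
    have "x = y" using a(5) nin(2) by blast
    moreover from this have "R = R'" using a(5) nin by (metis insert_ident)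
    ultimately show "x = y \<and> R = R'" by simp
  qed
  have Fr: "insert x R \<in> nsets V r" if "x \<in> T" "R \<in> nsets S (r - 1)" for x R
  proof -
    have "x \<notin> R" "finite R" using that TS by (auto simp: nsets_def)
    then show ?thesis using that V d r by (auto simp: nsets_def)
  qed
  have sub: "E \<subseteq> nsets V r"
    unfolding E F using Fr V nsets_mono[of A V r] by auto
  show U: "uniform_hypergraph r V E" using sub V fT by (simp add: uniform_hypergraph_def)
  show cV: "card V = n" using V fT d(1) c s by (simp add: card_Un_disjoint)
  have cn: "card (nsets X j) = card X choose j" if "finite X" for X :: "'a set" and j
    using n_subsets[OF that, of j] that by (simp add: nsets_def finite_subset conj_commute
      cong: conj_cong)
  have fin: "finite E" using sub V fT finite_imp_finite_nsets finite_subset by (metis finite_UnI)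
  have "nsets A r \<inter> ?F = {}" using d by (auto simp: nsets_def)
  then have "card E = card (nsets A r) + card ?F"
    unfolding E using fin E by (intro card_Un_disjoint) auto
  also have "card ?F = s * (s choose (r - 1))"
    unfolding F using card_image[OF inj] cn[OF fS] c by (simp add: card_cartesian_product)
  finally show "card E = g r n s" using cn[OF fT(2)] c by (simp add: g_def)
  have degI: "card X \<le> degree E x" if "h ` X \<subseteq> {f \<in> E. x \<in> f}" "inj_on h X"
    for h :: "'a set \<Rightarrow> 'a set" and X x
    using card_mono[OF _ that(1)] fin card_image[OF that(2)] by (simp add: degree_def)
  have "k \<le> degree E x" if x: "x \<in> V" for x
  proof (cases "x \<in> T")
    case True
    have "(insert x) ` nsets S (r - 1) \<subseteq> {f \<in> E. x \<in> f}" using True E by auto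
    moreover have "inj_on (insert x) (nsets S (r - 1))"
      using inj_on_subset[OF inj, of "{x} \<times> nsets S (r - 1)"] True by (auto simp: inj_on_def)
    ultimately have "card (nsets S (r - 1)) \<le> degree E x"
      by (intro degI)
    then show ?thesis using cn[OF fS] c k by simp
  next
    case False
    then have xA: "x \<in> A" using x V by blast
    have ins: "insert x R \<in> nsets A r" if "R \<in> nsets (A - {x}) (r - 1)" for R
      using that xA r by (auto simp: nsets_def card_insert_if)
    have "(insert x) ` nsets (A - {x}) (r - 1) \<subseteq> {f \<in> E. x \<in> f}" using ins E by auto
    moreover have "inj_on (insert x) (nsets (A - {x}) (r - 1))"
      by (rule inj_onI) (auto simp: nsets_def)
    ultimately have "card (nsets (A - {x}) (r - 1)) \<le> degree E x"
      by (intro degI)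
    then show ?thesis using cn[of "A - {x}"] fT(2) xA c k by (simp add: card_Diff_singleton)
  qed
  moreover have "V \<noteq> {}" using cV s by auto
  moreover have "finite V" using V fT by simp
  ultimately show "k \<le> min_degree V E" by (simp add: min_degree_def)
qed

theorem theorem1p3:
  fixes r n k t :: nat
  assumes "r \<ge> 3" and "n > 2 * r"
    and "r + 1 \<le> k" and "k < (((n - 1) div 2) choose (r - 1))"
    and "((t - 1) choose (r - 1)) < k" and "k \<le> (t choose (r - 1))"
  shows
    "(\<forall>(V :: 'a set) E.
        uniform_hypergraph r V E \<and> card V = n \<and>
        \<not> has_berge_hamiltonian_cycle V E \<and> min_degree V E \<ge> k \<longrightarrow>
        card E \<le> (if odd n
                   then max (g r n t) (g r n ((n - 1) div 2))
                   else max (g r n t) (g r n ((n - 2) div 2) + (n div 2 - 1))))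
     \<and>
     (odd n \<longrightarrow>
        (\<forall>s \<in> {t, (n - 1) div 2}.
           g r n s = max (g r n t) (g r n ((n - 1) div 2)) \<longrightarrow>
           (\<exists>(V :: nat set) E. is_H1 r n s V E) \<and>
           (\<forall>(V :: 'a set) E. is_H1 r n s V E \<longrightarrow>
              uniform_hypergraph r V E \<and> card V = n \<and>
              \<not> has_berge_hamiltonian_cycle V E \<and> min_degree V E \<ge> k \<and>
              card E = g r n s)))"
proof (intro conjI)
  show "\<forall>(V :: 'a set) E.
        uniform_hypergraph r V E \<and> card V = n \<and>
        \<not> has_berge_hamiltonian_cycle V E \<and> min_degree V E \<ge> k \<longrightarrow>
        card E \<le> (if odd n
                   then max (g r n t) (g r n ((n - 1) div 2))
                   else max (g r n t) (g r n ((n - 2) div 2) + (n div 2 - 1)))"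
    using card_edges_bound[OF assms(1-5)] by blast
next
  let ?m = "(n - 1) div 2"
  have tm: "t \<le> ?m" using assms(4,5) by (intro parameter_le[of t r k ?m]) simp_all
  have t0: "0 < t"
  proof (rule ccontr)
    assume "\<not> 0 < t"
    then show False using assms(1,3,6) by (simp add: binomial_eq_0)
  qed
  have "(\<exists>(V :: nat set) E. is_H1 r n s V E) \<and>
           (\<forall>(V :: 'a set) E. is_H1 r n s V E \<longrightarrow>
              uniform_hypergraph r V E \<and> card V = n \<and>
              \<not> has_berge_hamiltonian_cycle V E \<and> min_degree V E \<ge> k \<and>
              card E = g r n s)" if "s \<in> {t, ?m}" for s
  proof -
    have s: "t \<le> s" "s \<le> ?m" using that tm by auto
    then have s': "0 < s" "2 * s < n" "2 * s \<le> n" "0 < n" using t0 assms(2) by linarith+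
    have k1: "k \<le> s choose (r - 1)" using assms(6) binomial_right_mono[OF s(1)] by (rule order_trans)
    have "?m \<le> n - s - 1" using s by linarith
    then have k2: "k \<le> (n - s - 1) choose (r - 1)"
      using assms(4) binomial_right_mono[of ?m "n - s - 1" "r - 1"] by linarith
    have "2 \<le> r" using assms(1) by simp
    note H1 = is_H1_not_hamiltonian[OF _ s'(1,2)] is_H1_properties[OF _ \<open>2 \<le> r\<close> s'(3,4) k1 k2]
    show ?thesis by (intro conjI allI impI; (rule is_H1_exists[OF s'(3)] | erule H1))
  qed
  then show "odd n \<longrightarrow>
        (\<forall>s \<in> {t, (n - 1) div 2}.
           g r n s = max (g r n t) (g r n ((n - 1) div 2)) \<longrightarrow>
           (\<exists>(V :: nat set) E. is_H1 r n s V E) \<and>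
           (\<forall>(V :: 'a set) E. is_H1 r n s V E \<longrightarrow>
              uniform_hypergraph r V E \<and> card V = n \<and>
              \<not> has_berge_hamiltonian_cycle V E \<and> min_degree V E \<ge> k \<and>
              card E = g r n s))"
    by blast
qed

end
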